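(* Let $X$ be a proper geodesic Gromov hyperbolic space with a pole. Then the following conditions are equivalent: (1) $X$ is boundary rigid; (2) $\partial X$ is uniformly perfect.
   Context: Quasi-isometries: a map $f:(X,d)\to(Y,d')$ is a $(K,C)$-quasi-isometric embedding ($K\ge 1$, $C\ge 0$) if $K^{-1}d(x,y)-C\le d'(f(x),f(y))\le Kd(x,y)+C$ for all $x,y\in X$; it is a $(K,C)$-quasi-isometry if in addition every point of $Y$ is within distance $C$ of $f(X)$; a quasi-isometry is a $(K,C)$-quasi-isometry for some $K,C$ (maps need not be continuous). Hyperbolicity: a geodesic metric space $X$ is $\delta$-hyperbolic ($\delta\ge 0$) if each side of every geodesic triangle lies in the closed $\delta$-neighborhood of the other two sides; Gromov hyperbolic means $\delta$-hyperbolic for some $\delta$. For a base point $w\in X$, $(x|y)_w=\frac12(d(x,w)+d(y,w)-d(x,y))$. A sequence $\{x_i\}$ in $X$ is a Gromov sequence if $(x_i|x_j)_w\to\infty$ as $i,j\to\infty$; two Gromov sequences are equivalent if $(x_i|y_i)_w\to\infty$. The Gromov boundary $\partial X$ is the set of equivalence classes, and $\bar X=X\cup\partial X$. A quasi-isometry $f:X\to X$ of a geodesic hyperbolic space induces a map $\partial f:\partial X\to\partial X$ sending the class of $\{x_i\}$ to the class of $\{f(x_i)\}$. Boundary rigid: $X$ is boundary rigid if every quasi-isometry $f:X\to X$ with $\partial f=\mathrm{id}_{\partial X}$ satisfies $\sup_{x\in X}d(x,f(x))<\infty$. Pole: a proper geodesic (Gromov hyperbolic) space $X$ has an $L$-pole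 ($L\ge 0$) if there is $o\in\bar X$ such that each point of $X$ lies in the $L$-neighborhood of some geodesic connecting $o$ to some $v\in\partial X$; $X$ has a pole if it has an $L$-pole for some $L\ge 0$. Visual metric: for $\xi,\zeta\in\partial X$, $(\xi|\zeta)_w=\inf\{\liminf_i (x_i|y_i)_w : \{x_i\}\in\xi,\{y_i\}\in\zeta\}$. If $X$ is $\delta$-hyperbolic with $\delta>0$ (with $\delta$ enlarged if necessary so that all geodesic triangles are also $\delta$-thin) and $0<\varepsilon<\min\{1,\frac1{5\delta}\}$, set $\rho_{w,\varepsilon}(\xi,\zeta)=e^{-\varepsilon(\xi|\zeta)_w}$ ($e^{-\infty}=0$) and $d_{w,\varepsilon}(\xi,\zeta)=\inf\sum_{i=1}^n\rho_{w,\varepsilon}(\xi_{i-1},\xi_i)$ over all finite chains $\xi=\xi_0,\dots,\xi_n=\zeta$ in $\partial X$. This is the visual metric. Uniformly perfect: a metric space $(Z,d)$ is $S$-uniformly perfect ($S\ge1$) if there is $r_0>0$ such that for each $x\in Z$ and every $0<r\le r_0$ there is $y\in Z$ with $r/S<d(x,y)\le r$; uniformly perfect means $S$-uniformly perfect for some $S\ge 1$. "$\partial X$ is uniformly perfect" means $(\partial X,d_{w,\varepsilon})$ is uniformly perfect for a visual metric; this does not depend on the choice of visual metric. *)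

theory Defs
  imports "HOL-Analysis.Analysis"
begin

text \<open>The space is a type of class \<^class>\<open>metric_space\<close>; properties of the space as a whole
  take it as an argument of type \<^typ>\<open>'a itself\<close>.\<close>

subsection \<open>Quasi-isometries\<close>

definition quasi_isometric_embedding ::
  "real \<Rightarrow> real \<Rightarrow> ('a::metric_space \<Rightarrow> 'b::metric_space) \<Rightarrow> bool" where
  "quasi_isometric_embedding K C f \<longleftrightarrow> 1 \<le> K \<and> 0 \<le> C \<and>
     (\<forall>x y. dist x y / K - C \<le> dist (f x) (f y) \<and> dist (f x) (f y) \<le> K * dist x y + C)"

definition quasi_isometry_with ::
  "real \<Rightarrow> real \<Rightarrow> ('a::metric_space \<Rightarrow> 'b::metric_space) \<Rightarrow> bool" where
  "quasi_isometry_with K C f \<longleftrightarrow>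
     quasi_isometric_embedding K C f \<and> (\<forall>y. \<exists>x. dist y (f x) \<le> C)"

definition quasi_isometry :: "('a::metric_space \<Rightarrow> 'b::metric_space) \<Rightarrow> bool" where
  "quasi_isometry f \<longleftrightarrow> (\<exists>K C. quasi_isometry_with K C f)"

subsection \<open>Geodesics and hyperbolicity\<close>

definition geodesic_on :: "real set \<Rightarrow> (real \<Rightarrow> 'a::metric_space) \<Rightarrow> bool" where
  "geodesic_on I \<gamma> \<longleftrightarrow> (\<forall>s\<in>I. \<forall>t\<in>I. dist (\<gamma> s) (\<gamma> t) = \<bar>s - t\<bar>)"

definition geodesic_segment :: "'a::metric_space \<Rightarrow> 'a \<Rightarrow> 'a set \<Rightarrow> bool" where
  "geodesic_segment x y A \<longleftrightarrow> (\<exists>\<gamma>. geodesic_on {0..dist x y} \<gamma> \<and>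
     \<gamma> 0 = x \<and> \<gamma> (dist x y) = y \<and> A = \<gamma> ` {0..dist x y})"

definition geodesic_space :: "'a::metric_space itself \<Rightarrow> bool" where
  "geodesic_space (_ :: 'a itself) \<longleftrightarrow> (\<forall>x y :: 'a. \<exists>A. geodesic_segment x y A)"

definition geodesic_triangle ::
  "'a::metric_space \<Rightarrow> 'a \<Rightarrow> 'a \<Rightarrow> 'a set \<Rightarrow> 'a set \<Rightarrow> 'a set \<Rightarrow> bool" where
  "geodesic_triangle x y z A B C \<longleftrightarrow>
     geodesic_segment x y A \<and> geodesic_segment y z B \<and> geodesic_segment z x C"

definition in_nbhd :: "real \<Rightarrow> 'a::metric_space set \<Rightarrow> 'a set \<Rightarrow> bool" where
  "in_nbhd r A B \<longleftrightarrow> (\<forall>p\<in>A. \<exists>q\<in>B. dist p q \<le> r)"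

definition delta_hyperbolic :: "real \<Rightarrow> 'a::metric_space itself \<Rightarrow> bool" where
  "delta_hyperbolic \<delta> (_ :: 'a itself) \<longleftrightarrow> 0 \<le> \<delta> \<and>
     (\<forall>(x::'a) y z A B C. geodesic_triangle x y z A B C \<longrightarrow>
        in_nbhd \<delta> A (B \<union> C) \<and> in_nbhd \<delta> B (C \<union> A) \<and> in_nbhd \<delta> C (A \<union> B))"

definition gromov_hyperbolic :: "'a::metric_space itself \<Rightarrow> bool" where
  "gromov_hyperbolic (_ :: 'a itself) \<longleftrightarrow> (\<exists>\<delta>. delta_hyperbolic \<delta> TYPE('a))"

definition gromov_product :: "'a::metric_space \<Rightarrow> 'a \<Rightarrow> 'a \<Rightarrow> real" where
  "gromov_product w x y = (dist x w + dist y w - dist x y) / 2"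

text \<open>A triangle is \<open>\<delta>\<close>-thin if the fibres of its comparison map to a tripod have diameter at most
  \<open>\<delta>\<close>. Two points on the sides issuing from a vertex \<open>v\<close> have the same image in the leg of \<open>v\<close> iff
  they are at the same distance from \<open>v\<close> and this distance is at most the length of the leg, which
  is the Gromov product at \<open>v\<close> of the other two vertices.\<close>

definition thin_at ::
  "real \<Rightarrow> 'a::metric_space \<Rightarrow> 'a \<Rightarrow> 'a \<Rightarrow> 'a set \<Rightarrow> 'a set \<Rightarrow> bool" where
  "thin_at \<delta> v x y A B \<longleftrightarrow>
     (\<forall>p\<in>A. \<forall>q\<in>B. dist v p = dist v q \<and> dist v p \<le> gromov_product v x y \<longrightarrow> dist p q \<le> \<delta>)"

definition thin_triangles :: "real \<Rightarrow> 'a::metric_space itself \<Rightarrow> bool" where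
  "thin_triangles \<delta> (_ :: 'a itself) \<longleftrightarrow>
     (\<forall>(x::'a) y z A B C. geodesic_triangle x y z A B C \<longrightarrow>
        thin_at \<delta> x y z A C \<and> thin_at \<delta> y z x B A \<and> thin_at \<delta> z x y C B)"

subsection \<open>The Gromov boundary\<close>

text \<open>The following two notions do not depend on the base point \<open>w\<close> (see the lemmas below), so we
  quantify over it instead of carrying it as a parameter.\<close>

definition gromov_sequence :: "(nat \<Rightarrow> 'a::metric_space) \<Rightarrow> bool" where
  "gromov_sequence x \<longleftrightarrow> (\<forall>w. filterlim (\<lambda>(i, j). gromov_product w (x i) (x j)) at_top
     (sequentially \<times>\<^sub>F sequentially))"

definition gromov_rel :: "((nat \<Rightarrow> 'a::metric_space) \<times> (nat \<Rightarrow> 'a)) set" where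
  "gromov_rel = {(x, y). gromov_sequence x \<and> gromov_sequence y \<and>
     (\<forall>w. filterlim (\<lambda>i. gromov_product w (x i) (y i)) at_top sequentially)}"

lemma gromov_product_base: "gromov_product w x y - dist w w' \<le> gromov_product w' x y"
  using dist_triangle[of x w w'] dist_triangle[of y w w']
  unfolding gromov_product_def by (simp add: dist_commute field_simps)

lemma filterlim_gromov_product_base:
  assumes "filterlim (\<lambda>n. gromov_product w (f n) (g n)) at_top F"
  shows "filterlim (\<lambda>n. gromov_product w' (f n) (g n)) at_top F"
proof (rule filterlim_at_top_mono)
  show "filterlim (\<lambda>n. - dist w w' + gromov_product w (f n) (g n)) at_top F"
    by (rule filterlim_tendsto_add_at_top[OF tendsto_const assms])
  show "\<forall>\<^sub>F n in F. - dist w w' + gromov_product w (f n) (g n) \<le> gromov_product w' (f n) (g n)"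
    using gromov_product_base[of w "f n" "g n" w' for n] by (simp add: algebra_simps)
qed

lemma gromov_sequence_iff:
  "gromov_sequence x \<longleftrightarrow> filterlim (\<lambda>(i, j). gromov_product w (x i) (x j)) at_top
     (sequentially \<times>\<^sub>F sequentially)"
  unfolding gromov_sequence_def case_prod_beta
  using filterlim_gromov_product_base[of _ "\<lambda>p. x (fst p)" "\<lambda>p. x (snd p)"] by blast

lemma gromov_rel_iff:
  "(x, y) \<in> gromov_rel \<longleftrightarrow> gromov_sequence x \<and> gromov_sequence y \<and>
     filterlim (\<lambda>i. gromov_product w (x i) (y i)) at_top sequentially"
  unfolding gromov_rel_def by (blast intro: filterlim_gromov_product_base)

definition gromov_boundary :: "(nat \<Rightarrow> 'a::metric_space) set set" where
  "gromov_boundary = Collect gromov_sequence // gromov_rel"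

text \<open>The map induced on classes: for a quasi-isometry of geodesic hyperbolic spaces, all sets in
  the union are one and the same class.\<close>

definition boundary_map ::
  "('a::metric_space \<Rightarrow> 'b::metric_space) \<Rightarrow> (nat \<Rightarrow> 'a) set \<Rightarrow> (nat \<Rightarrow> 'b) set" where
  "boundary_map f \<xi> = (\<Union>x\<in>\<xi>. gromov_rel `` {f \<circ> x})"

definition boundary_rigid :: "'a::metric_space itself \<Rightarrow> bool" where
  "boundary_rigid (_ :: 'a itself) \<longleftrightarrow>
     (\<forall>f :: 'a \<Rightarrow> 'a. quasi_isometry f \<and> (\<forall>\<xi>\<in>gromov_boundary. boundary_map f \<xi> = \<xi>) \<longrightarrow>
        bdd_above (range (\<lambda>x. dist x (f x))))"

subsection \<open>Poles\<close>

text \<open>The left summand of \<open>UNIV <+> gromov_boundary\<close> is the space, the right one its boundary. A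
  geodesic ray \<open>\<gamma>\<close> ends at the class of \<open>\<gamma>(0), \<gamma>(1), \<dots>\<close>, which is also the class of any other
  sequence \<open>\<gamma>(t\<^sub>i)\<close> with \<open>t\<^sub>i \<longlonglongrightarrow> \<infinity>\<close>.\<close>

definition gromov_closure :: "('a::metric_space + (nat \<Rightarrow> 'a) set) set" where
  "gromov_closure = UNIV <+> gromov_boundary"

fun geodesic_connecting ::
  "'a::metric_space + (nat \<Rightarrow> 'a) set \<Rightarrow> (nat \<Rightarrow> 'a) set \<Rightarrow> 'a set \<Rightarrow> bool" where
  "geodesic_connecting (Inl p) v G \<longleftrightarrow>
     (\<exists>\<gamma>. geodesic_on {0..} \<gamma> \<and> \<gamma> 0 = p \<and> (\<lambda>n. \<gamma> (real n)) \<in> v \<and> G = \<gamma> ` {0..})"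
| "geodesic_connecting (Inr u) v G \<longleftrightarrow>
     (\<exists>\<gamma>. geodesic_on UNIV \<gamma> \<and> (\<lambda>n. \<gamma> (- real n)) \<in> u \<and> (\<lambda>n. \<gamma> (real n)) \<in> v \<and> G = range \<gamma>)"

definition has_L_pole :: "real \<Rightarrow> 'a::metric_space itself \<Rightarrow> bool" where
  "has_L_pole L (_ :: 'a itself) \<longleftrightarrow> 0 \<le> L \<and>
     (\<exists>p \<in> (gromov_closure :: ('a + (nat \<Rightarrow> 'a) set) set). \<forall>x. \<exists>v\<in>gromov_boundary.
        \<exists>G. geodesic_connecting p v G \<and> in_nbhd L {x} G)"

definition has_pole :: "'a::metric_space itself \<Rightarrow> bool" where
  "has_pole (_ :: 'a itself) \<longleftrightarrow> (\<exists>L. has_L_pole L TYPE('a))"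

subsection \<open>Visual metrics and uniform perfectness\<close>

definition boundary_product ::
  "'a::metric_space \<Rightarrow> (nat \<Rightarrow> 'a) set \<Rightarrow> (nat \<Rightarrow> 'a) set \<Rightarrow> ereal" where
  "boundary_product w \<xi> \<zeta> =
     Inf {liminf (\<lambda>i. ereal (gromov_product w (x i) (y i))) | x y. x \<in> \<xi> \<and> y \<in> \<zeta>}"

definition visual_rho ::
  "'a::metric_space \<Rightarrow> real \<Rightarrow> (nat \<Rightarrow> 'a) set \<Rightarrow> (nat \<Rightarrow> 'a) set \<Rightarrow> real" where
  "visual_rho w \<epsilon> \<xi> \<zeta> = (if boundary_product w \<xi> \<zeta> = \<infinity> then 0
     else exp (- \<epsilon> * real_of_ereal (boundary_product w \<xi> \<zeta>)))"

definition visual_dist ::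
  "'a::metric_space \<Rightarrow> real \<Rightarrow> (nat \<Rightarrow> 'a) set \<Rightarrow> (nat \<Rightarrow> 'a) set \<Rightarrow> real" where
  "visual_dist w \<epsilon> \<xi> \<zeta> = Inf {\<Sum>i=1..n::nat. visual_rho w \<epsilon> (c (i - 1)) (c i) | n c.
     1 \<le> n \<and> c 0 = \<xi> \<and> c n = \<zeta> \<and> (\<forall>i\<le>n. c i \<in> gromov_boundary)}"

definition visual_metric ::
  "((nat \<Rightarrow> 'a::metric_space) set \<Rightarrow> (nat \<Rightarrow> 'a) set \<Rightarrow> real) \<Rightarrow> bool" where
  "visual_metric d \<longleftrightarrow> (\<exists>w \<delta> \<epsilon>. 0 < \<delta> \<and> delta_hyperbolic \<delta> TYPE('a) \<and> thin_triangles \<delta> TYPE('a) \<and>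
     0 < \<epsilon> \<and> \<epsilon> < min 1 (1 / (5 * \<delta>)) \<and> d = visual_dist w \<epsilon>)"

definition S_uniformly_perfect :: "real \<Rightarrow> 'z set \<Rightarrow> ('z \<Rightarrow> 'z \<Rightarrow> real) \<Rightarrow> bool" where
  "S_uniformly_perfect S Z d \<longleftrightarrow> 1 \<le> S \<and>
     (\<exists>r\<^sub>0>0. \<forall>x\<in>Z. \<forall>r. 0 < r \<and> r \<le> r\<^sub>0 \<longrightarrow> (\<exists>y\<in>Z. r / S < d x y \<and> d x y \<le> r))"

definition uniformly_perfect :: "'z set \<Rightarrow> ('z \<Rightarrow> 'z \<Rightarrow> real) \<Rightarrow> bool" where
  "uniformly_perfect Z d \<longleftrightarrow> (\<exists>S. S_uniformly_perfect S Z d)"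

definition boundary_uniformly_perfect :: "'a::metric_space itself \<Rightarrow> bool" where
  "boundary_uniformly_perfect (_ :: 'a itself) \<longleftrightarrow>
     (\<exists>d. visual_metric d \<and> uniformly_perfect (gromov_boundary :: (nat \<Rightarrow> 'a) set set) d)"

end

theory Submission
  imports Defs
begin

text \<open>Everything is expressed by Gromov products \<open>(x|y)\<^sub>w\<close>, which measure for how long \<open>x\<close> and \<open>y\<close> lie in
  the same direction as seen from a base point \<open>w\<close>. Hyperbolicity enters through the four-point
  inequality \<open>(x|z)\<^sub>w \<ge> min (x|y)\<^sub>w (y|z)\<^sub>w - \<delta>\<close>, and boundary points through points far out on
  representing sequences.

  Two translations prepare the ground. The visual distance agrees up to a factor \<open>2\<close> with
  \<open>exp (- \<epsilon> * (\<xi>|\<zeta>)\<^sub>w)\<close>, so the boundary is uniformly perfect iff from every boundary point others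
  branch off at all large distances from \<open>w\<close>, up to a bounded error (\<open>uniformly_perfect_iff_branching\<close>).
  And a pole, wherever it is, makes every point of the space lie in the direction of some boundary
  point as seen from \<open>w\<close>, up to a bounded error (\<open>pole_at_base\<close>).

  Branching implies rigidity: by the pole and the branching, each point \<open>x\<close> far from \<open>w\<close> is a coarse
  centre of \<open>w\<close> and two boundary points \<open>\<xi>\<close>, \<open>\<zeta>\<close>. A quasi-isometry \<open>f\<close> maps coarse centres to coarse
  centres, by stability of quasi-geodesics (\<open>quasi_isometric_embedding_gp_bounded\<close>). If it fixes the
  boundary, then \<open>f x\<close> is a coarse centre of \<open>w\<close>, \<open>\<xi>\<close>, \<open>\<zeta>\<close> too, up to the constant \<open>dist w (f w)\<close>, and
  coarse centres are unique up to a bounded error (\<open>boundary_rigid_of_branching\<close>).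

  Rigidity implies branching: if branching fails, there are arbitrarily long corridors, that is,
  geodesic segments pointing away from \<open>w\<close> near which the space is nothing but a neighbourhood of the
  segment of a fixed radius (\<open>corridor_of_not_branching\<close>). The map that slides the points of infinitely many
  disjoint corridors along their axes, roughly keeps the ends of the corridors in place and is the identity
  elsewhere is a quasi-isometry that fixes the boundary, but it displaces points of long corridors by
  a fixed proportion of the length (\<open>not_boundary_rigid_of_corridors\<close>).\<close>

abbreviation gp :: "'a::metric_space \<Rightarrow> 'a \<Rightarrow> 'a \<Rightarrow> real" where
  "gp \<equiv> gromov_product"

section \<open>Gromov products\<close>

lemma two_gp: "2 * gp w x y = dist x w + dist y w - dist x y"
  by (simp add: gromov_product_def)

lemma gp_commute: "gp w x y = gp w y x"
  by (simp add: gromov_product_def dist_commute)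

lemma gp_nonneg: "0 \<le> gp w x y"
  using dist_triangle2[of x y w] by (simp add: gromov_product_def)

lemma gp_le_dist1: "gp w x y \<le> dist x w"
  using dist_triangle[of y w x] two_gp[of w x y] dist_commute[of y x] by linarith

lemma gp_le_dist2: "gp w x y \<le> dist y w"
  using gp_le_dist1 gp_commute by metis

lemma gp_self [simp]: "gp w x x = dist x w"
  by (simp add: gromov_product_def)

lemma gp_lipschitz: "gp w x z \<le> gp w y z + dist x y"
  using dist_triangle[of x w y] dist_triangle[of y z x] dist_commute[of y x]
    two_gp[of w x z] two_gp[of w y z] by linarith

lemma gp_lipschitz_base: "gp w x y \<le> gp w' x y + dist w w'"
  using gromov_product_base[of w x y w'] by linarith

lemma dist_eq_gp: "dist x y = dist x w + dist y w - 2 * gp w x y"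
  using two_gp[of w x y] by linarith

lemma gp_change_base: "gp x a b = gp w a b + dist x w - gp w x a - gp w x b"
  using dist_commute[of x a] dist_commute[of x b]
    two_gp[of w a b] two_gp[of w x a] two_gp[of w x b] two_gp[of x a b] by linarith

lemma gp_swap_base: "gp x w a = dist x w - gp w x a"
  using dist_commute[of x a] dist_commute[of x w] dist_commute[of a w]
    two_gp[of x w a] two_gp[of w x a] by linarith

lemma gp_geodesic:
  assumes "geodesic_on I \<gamma>" "s \<in> I" "t \<in> I" "u \<in> I" "s \<le> t" "t \<le> u"
  shows "gp (\<gamma> t) (\<gamma> s) (\<gamma> u) = 0"
  using assms by (simp add: gromov_product_def geodesic_on_def)

lemma gp_geodesic_start:
  assumes "geodesic_on I \<gamma>" "r \<in> I" "s \<in> I" "t \<in> I" "r \<le> s" "r \<le> t"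
  shows "gp (\<gamma> r) (\<gamma> s) (\<gamma> t) = min s t - r"
  using assms by (auto simp add: gromov_product_def geodesic_on_def min_def)

section \<open>Slim triangles, thin triangles and the four-point inequality\<close>

lemma geodesic_space_obtains:
  assumes "geodesic_space TYPE('a::metric_space)"
  obtains \<gamma> where "geodesic_on {0..dist x y} \<gamma>" "\<gamma> 0 = (x::'a)" "\<gamma> (dist x y) = y"
    "geodesic_segment x y (\<gamma> ` {0..dist x y})"
  using assms unfolding geodesic_space_def geodesic_segment_def by metis

lemma geodesic_segment_reverse:
  assumes "geodesic_segment x y A" shows "geodesic_segment y x A"
proof -
  obtain \<gamma> where g: "geodesic_on {0..dist x y} \<gamma>" "\<gamma> 0 = x" "\<gamma> (dist x y) = y"
    "A = \<gamma> ` {0..dist x y}"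
    using assms unfolding geodesic_segment_def by blast
  let ?g = "\<lambda>t. \<gamma> (dist x y - t)"
  have "geodesic_on {0..dist y x} ?g"
    unfolding geodesic_on_def
  proof (intro ballI)
    fix s t assume "s \<in> {0..dist y x}" "t \<in> {0..dist y x}"
    then have "dist x y - s \<in> {0..dist x y}" "dist x y - t \<in> {0..dist x y}"
      by (auto simp: dist_commute[of y x])
    then show "dist (\<gamma> (dist x y - s)) (\<gamma> (dist x y - t)) = \<bar>s - t\<bar>"
      using g(1) unfolding geodesic_on_def by fastforce
  qed
  moreover have "A = ?g ` {0..dist y x}"
  proof -
    have "(\<lambda>t. dist x y - t) ` {0..dist x y} = {0..dist x y}"
      by simp
    then have "?g ` {0..dist x y} = \<gamma> ` {0..dist x y}"
      by (subst image_image[of \<gamma> "\<lambda>t. dist x y - t", symmetric]) (simp only:)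
    then show ?thesis unfolding g(4) dist_commute[of y x] by (rule sym)
  qed
  ultimately show ?thesis
    unfolding geodesic_segment_def using g(2,3)
    by (intro exI[of _ ?g]) (simp add: dist_commute)
qed

lemma geodesic_segment_dist:
  assumes "geodesic_segment x y A" "p \<in> A" "q \<in> A"
  shows "dist x p + dist p y = dist x y" "dist p q = \<bar>dist x p - dist x q\<bar>"
proof -
  obtain \<gamma> where g: "geodesic_on {0..dist x y} \<gamma>" "\<gamma> 0 = x" "\<gamma> (dist x y) = y"
    "A = \<gamma> ` {0..dist x y}"
    using assms(1) unfolding geodesic_segment_def by blast
  obtain s t where s: "p = \<gamma> s" "0 \<le> s" "s \<le> dist x y" and t: "q = \<gamma> t" "0 \<le> t" "t \<le> dist x y"
    using assms g by auto
  have *: "dist (\<gamma> u) (\<gamma> v) = \<bar>u - v\<bar>" if "0 \<le> u" "u \<le> dist x y" "0 \<le> v" "v \<le> dist x y" for u v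
    using g(1) that unfolding geodesic_on_def by auto
  have "dist x p = s" "dist x q = t" "dist p q = \<bar>s - t\<bar>" "dist p y = dist x y - s"
    using *[of 0 s] *[of 0 t] *[of s t] *[of s "dist x y"] s(2,3) t(2,3)
    unfolding g(2,3) s(1)[symmetric] t(1)[symmetric] by simp_all
  then show "dist x p + dist p y = dist x y" "dist p q = \<bar>dist x p - dist x q\<bar>" by simp_all
qed

text \<open>A point \<open>p\<close> of the leg at \<open>x\<close> that is close to the opposite side can only lie near the end of
  the leg, and so does its companion \<open>q\<close>; both are then close to points of the opposite side that
  have almost the same position there.\<close>

lemma thin_at_of_delta_hyperbolic:
  assumes hyp: "delta_hyperbolic \<delta> TYPE('a::metric_space)"
    and tri: "geodesic_triangle (x::'a) y z A B C"
  shows "thin_at (6 * \<delta>) x y z A C"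
  unfolding thin_at_def
proof (intro ballI impI)
  fix p q assume p: "p \<in> A" and q: "q \<in> C"
    and *: "dist x p = dist x q \<and> dist x p \<le> gromov_product x y z"
  have A: "geodesic_segment x y A" and B: "geodesic_segment y z B" and C: "geodesic_segment x z C"
    using tri geodesic_segment_reverse unfolding geodesic_triangle_def by blast+
  have \<delta>: "0 \<le> \<delta>" and near: "in_nbhd \<delta> A (B \<union> C)" "in_nbhd \<delta> C (A \<union> B)"
    using hyp tri unfolding delta_hyperbolic_def by blast+
  obtain p' where p': "p' \<in> B \<union> C" "dist p p' \<le> \<delta>" using near(1) p unfolding in_nbhd_def by blast
  obtain q' where q': "q' \<in> A \<union> B" "dist q q' \<le> \<delta>" using near(2) q unfolding in_nbhd_def by blast
  consider "p' \<in> C" | "q' \<in> A" | "p' \<in> B" "q' \<in> B" using p' q' by blast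
  then show "dist p q \<le> 6 * \<delta>"
  proof cases
    case 1
    then show ?thesis
      using geodesic_segment_dist(2)[OF C 1 q] p'(2) * \<delta> dist_triangle[of p q p']
        dist_triangle[of x p p'] dist_triangle[of x p' p] dist_commute[of p' p] by linarith
  next
    case 2
    then show ?thesis
      using geodesic_segment_dist(2)[OF A p 2] q'(2) * \<delta> dist_triangle[of p q q']
        dist_triangle[of x q q'] dist_triangle[of x q' q] dist_commute[of q' q] by linarith
  next
    case 3
    have "dist p' q' = \<bar>dist y p' - dist y q'\<bar>" by (rule geodesic_segment_dist(2)[OF B 3])
    moreover have "dist y p' + dist p' z = dist y z" "dist y q' + dist q' z = dist y z"
      using geodesic_segment_dist(1)[OF B] 3 by blast+
    moreover have "dist x p + dist p y = dist x y" "dist x q + dist q z = dist x z"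
      using geodesic_segment_dist(1)[OF A p p] geodesic_segment_dist(1)[OF C q q] by auto
    moreover have "dist y p' \<le> dist p y + \<delta>" "dist p y \<le> dist y p' + \<delta>"
      "dist q' z \<le> dist q z + \<delta>" "dist q z \<le> dist q' z + \<delta>"
      using p'(2) q'(2) dist_triangle[of y p' p] dist_triangle[of y p p']
       dist_triangle[of q' z q] dist_triangle[of q z q'] dist_triangle[of p y p']
       dist_commute[of p' p] dist_commute[of q' q] dist_commute[of y p] dist_commute[of y p'] by linarith+
    moreover have "dist x z \<le> dist x p + \<delta> + dist p' z"
      using dist_triangle[of x z p] dist_triangle[of p z p'] p'(2) by linarith
    moreover have "dist x y + dist x z - dist y z \<ge> 2 * dist x p"
      using * two_gp[of x y z] dist_commute[of x y] dist_commute[of x z] by linarith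
    moreover have "dist p q \<le> dist p p' + dist p' q' + dist q' q"
      using dist_triangle[of p q p'] dist_triangle[of p' q q'] by linarith
    ultimately show ?thesis using * p'(2) q'(2) \<delta> dist_commute[of q' q] by linarith
  qed
qed

lemma thin_triangles_of_delta_hyperbolic:
  assumes "delta_hyperbolic \<delta> TYPE('a::metric_space)"
  shows "thin_triangles (6 * \<delta>) TYPE('a)"
  unfolding thin_triangles_def
proof (intro allI impI)
  fix x y z :: 'a and A B C
  assume tri: "geodesic_triangle x y z A B C"
  then have "geodesic_triangle y z x B C A" "geodesic_triangle z x y C A B"
    unfolding geodesic_triangle_def by blast+
  with tri show "thin_at (6 * \<delta>) x y z A C \<and> thin_at (6 * \<delta>) y z x B A \<and> thin_at (6 * \<delta>) z x y C B"
    using thin_at_of_delta_hyperbolic[OF assms] by blast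
qed

lemma delta_hyperbolic_mono:
  assumes "delta_hyperbolic \<delta> TYPE('a::metric_space)" "\<delta> \<le> \<delta>'"
  shows "delta_hyperbolic \<delta>' TYPE('a)"
  using assms unfolding delta_hyperbolic_def in_nbhd_def by (meson order_trans)

lemma thin_triangles_mono:
  assumes "thin_triangles \<delta> TYPE('a::metric_space)" "\<delta> \<le> \<delta>'"
  shows "thin_triangles \<delta>' TYPE('a)"
  using assms unfolding thin_triangles_def thin_at_def by (meson order_trans)

text \<open>The three points at distance \<open>min (x|y)\<^sub>w (y|z)\<^sub>w\<close> from \<open>w\<close> on geodesics to \<open>x\<close>, \<open>y\<close>, \<open>z\<close> are
  consecutively \<open>\<delta>\<close>-close, which bounds \<open>dist x z\<close>.\<close>

lemma four_point_of_thin_triangles: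
  assumes geo: "geodesic_space TYPE('a::metric_space)" and thin: "thin_triangles \<delta> TYPE('a)"
  shows "min (gp w x y) (gp w y z) - \<delta> \<le> gp w x (z::'a)"
proof -
  define m where "m = min (gp w x y) (gp w y z)"
  have close: "dist p q \<le> \<delta>" if "geodesic_segment w u A" "geodesic_segment w v A'" "p \<in> A" "q \<in> A'"
    "dist w p = m" "dist w q = m" "m \<le> gp w u v" for u v A A' p q
  proof -
    obtain \<gamma> where "geodesic_segment u v (\<gamma> ` {0..dist u v})"
      using geodesic_space_obtains[OF geo] by metis
    then have "geodesic_triangle w u v A (\<gamma> ` {0..dist u v}) A'"
      using that geodesic_segment_reverse unfolding geodesic_triangle_def by blast
    then have "thin_at \<delta> w u v A A'" using thin unfolding thin_triangles_def by blast
    then show ?thesis using that unfolding thin_at_def by simp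
  qed
  have point: "\<exists>A p. geodesic_segment w u A \<and> p \<in> A \<and> dist w p = m" if "m \<le> dist u w" for u
  proof -
    obtain \<gamma> where g: "geodesic_on {0..dist w u} \<gamma>" "\<gamma> 0 = w" "geodesic_segment w u (\<gamma> ` {0..dist w u})"
      using geodesic_space_obtains[OF geo] by metis
    have m: "0 \<le> m" "m \<le> dist w u" using that gp_nonneg unfolding m_def by (auto simp: dist_commute)
    then have "dist w (\<gamma> m) = m"
      using g(1,2) unfolding geodesic_on_def by (metis abs_minus_commute abs_of_nonneg atLeastAtMost_iff
          diff_zero order_refl zero_le_dist)
    with g m show ?thesis by (intro exI[of _ "\<gamma> ` {0..dist w u}"] exI[of _ "\<gamma> m"]) auto
  qed
  have "m \<le> dist x w" "m \<le> dist y w" "m \<le> dist z w"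
    using gp_le_dist1[of w x y] gp_le_dist1[of w y z] gp_le_dist2[of w y z] unfolding m_def by auto
  then obtain A1 p1 A2 p2 A3 p3 where
    1: "geodesic_segment w x A1" "p1 \<in> A1" "dist w p1 = m" and
    2: "geodesic_segment w y A2" "p2 \<in> A2" "dist w p2 = m" and
    3: "geodesic_segment w z A3" "p3 \<in> A3" "dist w p3 = m" using point by metis
  have "dist p1 p2 \<le> \<delta>" "dist p2 p3 \<le> \<delta>"
    using close[OF 1(1) 2(1)] close[OF 2(1) 3(1)] 1 2 3 by (simp_all add: m_def)
  moreover have "dist p1 x = dist w x - m" "dist p3 z = dist w z - m"
    using geodesic_segment_dist(1)[OF 1(1,2,2)] geodesic_segment_dist(1)[OF 3(1,2,2)] 1 3 by auto
  ultimately have "dist x z \<le> dist x w + dist z w - 2 * m + 2 * \<delta>"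
    using dist_triangle[of x z p1] dist_triangle[of p1 z p2] dist_triangle[of p2 z p3]
    by (simp add: dist_commute)
  then show ?thesis unfolding m_def[symmetric] using two_gp[of w x z] by linarith
qed

text \<open>The parameter \<open>T\<close> names the type of the points, so that the locale can be interpreted for it.\<close>

locale gromov_space =
  fixes T :: "'a::metric_space itself" and \<delta> :: real
  assumes geodesic: "geodesic_space TYPE('a::metric_space)"
    and four_point: "min (gp w x y) (gp w y z) - \<delta> \<le> gp w x (z::'a)"
begin

lemma four_point2: "a \<le> gp w x y \<Longrightarrow> a \<le> gp w y z \<Longrightarrow> a - \<delta> \<le> gp w x (z::'a)"
  using four_point[of w x y z] by linarith

lemma delta_nonneg: "0 \<le> \<delta>"
  using four_point[of undefined undefined undefined undefined] by simp

lemma four_point3: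
  "a \<le> gp w x y \<Longrightarrow> a \<le> gp w y z \<Longrightarrow> a \<le> gp w z u \<Longrightarrow> a - 2 * \<delta> \<le> gp w x (u::'a)"
  using four_point[of w x y z] four_point[of w x z u] delta_nonneg by linarith

section \<open>The boundary\<close>

lemma gromov_sequence_iff_ge:
  "gromov_sequence x \<longleftrightarrow> (\<forall>R. \<exists>N. \<forall>i\<ge>N. \<forall>j\<ge>N. R \<le> gp w (x i) (x j))"
  unfolding gromov_sequence_iff[of _ w] filterlim_at_top case_prod_beta eventually_prod_sequentially
    fst_conv snd_conv by blast

lemma gromov_rel_iff_ge:
  "(x, y) \<in> gromov_rel \<longleftrightarrow> gromov_sequence x \<and> gromov_sequence y \<and>
     (\<forall>R. \<exists>N. \<forall>i\<ge>N. R \<le> gp w (x i) (y i))"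
  unfolding gromov_rel_iff[of _ _ w] filterlim_at_top eventually_sequentially by auto

lemma gromov_rel_cross:
  assumes "(x, y) \<in> gromov_rel"
  obtains N where "\<And>i j. N \<le> i \<Longrightarrow> N \<le> j \<Longrightarrow> R \<le> gp w (x i) (y j :: 'a)"
proof -
  obtain N1 where 1: "\<And>i. N1 \<le> i \<Longrightarrow> R + \<delta> \<le> gp w (x i) (y i)"
    using assms unfolding gromov_rel_iff_ge[of _ _ w] by metis
  obtain N2 where 2: "\<And>i j. N2 \<le> i \<Longrightarrow> N2 \<le> j \<Longrightarrow> R + \<delta> \<le> gp w (y i) (y j)"
    using assms unfolding gromov_rel_iff_ge[of _ _ w] gromov_sequence_iff_ge[of _ w] by metis
  show ?thesis
  proof (rule that[of "max N1 N2"])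
    fix i j assume "max N1 N2 \<le> i" "max N1 N2 \<le> j"
    then show "R \<le> gp w (x i) (y j)" using four_point2[OF 1[of i] 2[of i j]] by simp
  qed
qed

lemma gromov_rel_refl: "gromov_sequence x \<Longrightarrow> (x, x :: nat \<Rightarrow> 'a) \<in> gromov_rel"
  unfolding gromov_rel_iff_ge[of _ _ undefined] gromov_sequence_iff_ge[of _ undefined] by blast

lemma gromov_rel_sym: "(x, y) \<in> gromov_rel \<Longrightarrow> (y, x :: nat \<Rightarrow> 'a) \<in> gromov_rel"
  unfolding gromov_rel_iff_ge[of _ _ undefined] by (simp add: gp_commute)

lemma gromov_rel_trans:
  assumes "(x, y) \<in> gromov_rel" "(y, z :: nat \<Rightarrow> 'a) \<in> gromov_rel"
  shows "(x, z) \<in> gromov_rel"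
proof -
  have "\<exists>N. \<forall>i\<ge>N. R \<le> gp undefined (x i) (z i)" for R
  proof -
    obtain N1 where 1: "\<And>i j. N1 \<le> i \<Longrightarrow> N1 \<le> j \<Longrightarrow> R + \<delta> \<le> gp undefined (x i) (y j)"
      using gromov_rel_cross[OF assms(1)] by metis
    obtain N2 where 2: "\<And>i j. N2 \<le> i \<Longrightarrow> N2 \<le> j \<Longrightarrow> R + \<delta> \<le> gp undefined (y i) (z j)"
      using gromov_rel_cross[OF assms(2)] by metis
    have "R \<le> gp undefined (x i) (z i)" if "max N1 N2 \<le> i" for i
      using four_point2[OF 1[of i i] 2[of i i]] that by simp
    then show ?thesis by blast
  qed
  with assms show ?thesis unfolding gromov_rel_iff_ge[of _ _ undefined] by blast
qed

lemma boundary_class: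
  assumes "\<xi> \<in> gromov_boundary" "x \<in> \<xi>" shows "\<xi> = gromov_rel `` {x :: nat \<Rightarrow> 'a}"
  using assms gromov_rel_sym gromov_rel_trans unfolding gromov_boundary_def quotient_def by blast

lemma boundary_rel:
  assumes "\<xi> \<in> gromov_boundary" "x \<in> \<xi>" "y \<in> \<xi>" shows "(x, y :: nat \<Rightarrow> 'a) \<in> gromov_rel"
  using boundary_class[OF assms(1,2)] assms(3) by blast

lemma boundary_nonempty:
  assumes "\<xi> \<in> gromov_boundary" obtains x :: "nat \<Rightarrow> 'a" where "x \<in> \<xi>" "gromov_sequence x"
  using assms gromov_rel_refl unfolding gromov_boundary_def quotient_def by blast

lemma boundary_sequence:
  assumes "\<xi> \<in> gromov_boundary" "(x :: nat \<Rightarrow> 'a) \<in> \<xi>" shows "gromov_sequence x"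
  using boundary_rel[OF assms assms(2)] unfolding gromov_rel_def by blast

lemma boundary_far:
  assumes "\<xi> \<in> gromov_boundary" "x \<in> \<xi>" "y \<in> \<xi>"
  shows "\<forall>\<^sub>F i in sequentially. R \<le> gp w (x i) (y i :: 'a)"
  using boundary_rel[OF assms] unfolding gromov_rel_iff_ge[of _ _ w] eventually_sequentially by blast

text \<open>Passing from one representative of a boundary point to another costs one \<open>\<delta>\<close>, and
  turns infinitely many indices into almost all of them.\<close>

lemma frequently_gp_imp_eventually:
  assumes "\<xi> \<in> gromov_boundary" "y \<in> \<xi>" "y' \<in> \<xi>"
    and freq: "\<exists>\<^sub>F i in sequentially. a \<le> gp w x (y i :: 'a)"
  shows "\<forall>\<^sub>F i in sequentially. a - \<delta> \<le> gp w x (y' i)"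
proof -
  obtain N where N: "\<And>i j. N \<le> i \<Longrightarrow> N \<le> j \<Longrightarrow> a \<le> gp w (y i) (y' j)"
    using gromov_rel_cross[OF boundary_rel[OF assms(1-3)]] by metis
  obtain i where "N \<le> i" "a \<le> gp w x (y i)" using freq unfolding frequently_sequentially by blast
  then show ?thesis unfolding eventually_sequentially using N four_point2 by blast
qed

text \<open>Replacing both sequences by other representatives costs \<open>2 * \<delta>\<close>, so that a bound along a single
  pair of sequences controls the infimum over all pairs.\<close>

lemma boundary_product_ge:
  assumes "\<xi> \<in> gromov_boundary" "\<zeta> \<in> gromov_boundary" "x \<in> \<xi>" "y \<in> \<zeta>"
    and ev: "\<forall>\<^sub>F i in sequentially. a \<le> gp w (x i) (y i :: 'a)"
  shows "ereal (a - 2 * \<delta>) \<le> boundary_product w \<xi> \<zeta>"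
  unfolding boundary_product_def
proof (rule Inf_greatest, clarify)
  fix x' y' assume x': "x' \<in> \<xi>" and y': "y' \<in> \<zeta>"
  have "\<forall>\<^sub>F i in sequentially. ereal (a - 2 * \<delta>) \<le> ereal (gp w (x' i) (y' i))"
    using boundary_far[OF assms(1) x' assms(3), of a w] ev boundary_far[OF assms(2,4) y', of a w]
    by eventually_elim (simp add: four_point3)
  then show "ereal (a - 2 * \<delta>) \<le> liminf (\<lambda>i. ereal (gp w (x' i) (y' i)))"
    by (rule Liminf_bounded)
qed

lemma boundary_product_eventually:
  assumes "ereal a < boundary_product w \<xi> \<zeta>" "x \<in> \<xi>" "y \<in> \<zeta>"
  shows "\<forall>\<^sub>F i in sequentially. a < gp w (x i) (y i :: 'a)"
proof -
  have "boundary_product w \<xi> \<zeta> \<le> liminf (\<lambda>i. ereal (gp w (x i) (y i)))"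
    unfolding boundary_product_def by (rule Inf_lower) (use assms in blast)
  with assms(1) have "ereal a < liminf (\<lambda>i. ereal (gp w (x i) (y i)))" by simp
  then show ?thesis using less_LiminfD by force
qed

lemma boundary_product_frequently:
  assumes "\<xi> \<in> gromov_boundary" "\<zeta> \<in> gromov_boundary" "x \<in> \<xi>" "y \<in> \<zeta>"
    and "boundary_product w \<xi> \<zeta> < ereal (a - 2 * \<delta>)"
  shows "\<exists>\<^sub>F i in sequentially. gp w (x i) (y i :: 'a) < a"
  using boundary_product_ge[OF assms(1-4), of a w] assms(5)
  unfolding frequently_def not_less by (metis not_less)

lemma boundary_product_nonneg: "0 \<le> boundary_product w \<xi> (\<zeta> :: (nat \<Rightarrow> 'a) set)"
  unfolding boundary_product_def
  by (rule Inf_greatest) (auto intro!: Liminf_bounded simp: gp_nonneg)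

lemma boundary_product_self:
  assumes "\<xi> \<in> gromov_boundary" shows "boundary_product w \<xi> (\<xi> :: (nat \<Rightarrow> 'a) set) = \<infinity>"
proof (rule ereal_top)
  fix B
  obtain x where "x \<in> \<xi>" using boundary_nonempty[OF assms] by blast
  then show "ereal B \<le> boundary_product w \<xi> \<xi>"
    using boundary_product_ge[OF assms assms, of x x "B + 2 * \<delta>" w] boundary_far[OF assms, of x x "B + 2 * \<delta>" w] by simp
qed

text \<open>The infimum inherits the four-point inequality with the same \<open>\<delta>\<close>: a representative of \<open>\<eta>\<close> can be
  compared with every pair of representatives of \<open>\<xi>\<close> and \<open>\<zeta>\<close>.\<close>

lemma boundary_product_ultrametric:
  assumes "\<eta> \<in> gromov_boundary"
    and "ereal m \<le> boundary_product w \<xi> \<eta>" "ereal m \<le> boundary_product w \<eta> \<zeta>"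
  shows "ereal (m - \<delta>) \<le> boundary_product w \<xi> (\<zeta> :: (nat \<Rightarrow> 'a) set)"
proof (rule ccontr)
  assume "\<not> ?thesis"
  then obtain b where b: "boundary_product w \<xi> \<zeta> < ereal b" "ereal b < ereal (m - \<delta>)"
    unfolding not_le using ereal_dense2 by blast
  obtain y where y: "y \<in> \<eta>" using boundary_nonempty[OF assms(1)] by blast
  have less: "ereal (b + \<delta>) < boundary_product w \<xi> \<eta>" "ereal (b + \<delta>) < boundary_product w \<eta> \<zeta>"
    using b(2) assms(2,3) by (auto elim: order_less_le_trans[rotated])
  have "ereal b \<le> boundary_product w \<xi> \<zeta>"
    unfolding boundary_product_def
  proof (rule Inf_greatest, clarify)
    fix x z assume x: "x \<in> \<xi>" and z: "z \<in> \<zeta>"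
    have "\<forall>\<^sub>F i in sequentially. ereal b \<le> ereal (gp w (x i) (z i))"
      using boundary_product_eventually[OF less(1) x y] boundary_product_eventually[OF less(2) y z]
    proof eventually_elim
      case (elim i)
      then show ?case using four_point2[of "b + \<delta>" w "x i" "y i" "z i"] by simp
    qed
    then show "ereal b \<le> liminf (\<lambda>i. ereal (gp w (x i) (z i)))" by (rule Liminf_bounded)
  qed
  with b(1) show False by simp
qed

end

section \<open>Visual metrics\<close>

text \<open>Cut a chain of total length \<open>\<sigma>\<close> at the last point before which at most \<open>\<sigma> / 2\<close> has been used:
  both remaining parts have length at most \<open>\<sigma> / 2\<close>, so that by induction they contribute at most
  \<open>K\<^sup>2 * \<sigma> / 2 \<le> \<sigma>\<close>, and the link between them is at most \<open>\<sigma>\<close>. Two applications of the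
  quasi-ultrametric inequality put the three together at the price of \<open>K\<^sup>2\<close>.\<close>

lemma quasi_ultrametric_chain:
  fixes \<rho> :: "'z \<Rightarrow> 'z \<Rightarrow> real" and S :: "nat \<Rightarrow> real"
  assumes K: "1 \<le> K" "K\<^sup>2 \<le> 2"
    and nonneg: "\<And>x y. 0 \<le> \<rho> x y" and refl: "\<And>x. x \<in> Z \<Longrightarrow> \<rho> x x = 0"
    and ultra: "\<And>x y z. x \<in> Z \<Longrightarrow> y \<in> Z \<Longrightarrow> z \<in> Z \<Longrightarrow> \<rho> x z \<le> K * max (\<rho> x y) (\<rho> y z)"
    and c: "\<And>i. i \<le> n \<Longrightarrow> c i \<in> Z"
    and S: "\<And>i. i < n \<Longrightarrow> \<rho> (c i) (c (Suc i)) \<le> S (Suc i) - S i"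
    and "l \<le> m" "m \<le> n"
  shows "\<rho> (c l) (c m) \<le> K\<^sup>2 * (S m - S l)"
  using \<open>l \<le> m\<close> \<open>m \<le> n\<close>
proof (induction "m - l" arbitrary: l m rule: less_induct)
  case less
  show ?case
  proof (cases "l = m")
    case True
    then show ?thesis using refl c less.prems by simp
  next
    case False
    have mono: "S i \<le> S j" if "i \<le> j" "j \<le> n" for i j
      using that
    proof (induction rule: dec_induct)
      case (step k)
      then show ?case using S[of k] nonneg[of "c k" "c (Suc k)"] by linarith
    qed simp
    define \<sigma> where "\<sigma> = S m - S l"
    have \<sigma>: "0 \<le> \<sigma>" using mono less.prems unfolding \<sigma>_def by simp
    define P where "P = (\<lambda>k. l \<le> k \<and> k < m \<and> S k - S l \<le> \<sigma> / 2)"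
    define k where "k = (GREATEST k. P k)"
    have "P l" using False less.prems \<sigma> unfolding P_def by simp
    then have "P k" unfolding k_def by (rule GreatestI_nat[where b = m]) (simp add: P_def)
    then have k: "l \<le> k" "k < m" "S k - S l \<le> \<sigma> / 2" unfolding P_def by auto
    have rest: "S m - S (Suc k) \<le> \<sigma> / 2"
    proof (cases "Suc k = m")
      case True
      then show ?thesis using \<sigma> by simp
    next
      case False
      have "\<not> P (Suc k)"
        using Greatest_le_nat[of P "Suc k" m] unfolding k_def[symmetric] by (auto simp: P_def)
      then have "\<not> S (Suc k) - S l \<le> \<sigma> / 2" using False k unfolding P_def by simp
      then show ?thesis using \<sigma>_def by linarith
    qed
    have half: "K\<^sup>2 * a \<le> \<sigma>" if "a \<le> \<sigma> / 2" for a
    proof -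
      have "K\<^sup>2 * a \<le> K\<^sup>2 * (\<sigma> / 2)" using that by (intro mult_left_mono) auto
      also have "\<dots> \<le> 2 * (\<sigma> / 2)" using K(2) \<sigma> by (intro mult_right_mono) auto
      finally show ?thesis by simp
    qed
    have 1: "\<rho> (c l) (c k) \<le> \<sigma>" using less.hyps[of k l] half[OF k(3)] k less.prems by force
    have 2: "\<rho> (c k) (c (Suc k)) \<le> \<sigma>"
      using S[of k] mono[of l k] mono[of "Suc k" m] k less.prems unfolding \<sigma>_def by simp
    have 3: "\<rho> (c (Suc k)) (c m) \<le> \<sigma>"
      using less.hyps[of m "Suc k"] half[OF rest] k less.prems by force
    have "\<rho> (c k) (c m) \<le> K * max (\<rho> (c k) (c (Suc k))) (\<rho> (c (Suc k)) (c m))"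
      using ultra c k less.prems by simp
    also have "\<dots> \<le> K * \<sigma>" using 2 3 K by (intro mult_left_mono) auto
    finally have 4: "\<rho> (c k) (c m) \<le> K * \<sigma>" .
    have "\<rho> (c l) (c m) \<le> K * max (\<rho> (c l) (c k)) (\<rho> (c k) (c m))"
      using ultra c k less.prems by simp
    also have "\<dots> \<le> K * (K * \<sigma>)"
      using 1 4 K \<sigma> mult_right_mono[of 1 K \<sigma>] by (intro mult_left_mono) auto
    finally show ?thesis unfolding \<sigma>_def by (simp add: power2_eq_square mult.assoc)
  qed
qed

lemma visual_rho_nonneg: "0 \<le> visual_rho w \<epsilon> \<xi> \<zeta>"
  by (simp add: visual_rho_def)

context gromov_space
begin

lemma visual_rho_le_exp:
  assumes "0 < \<epsilon>"
  shows "visual_rho w \<epsilon> \<xi> (\<zeta> :: (nat \<Rightarrow> 'a) set) \<le> exp (- \<epsilon> * a) \<longleftrightarrow> ereal a \<le> boundary_product w \<xi> \<zeta>"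
  using assms boundary_product_nonneg[of w \<xi> \<zeta>]
  by (cases "boundary_product w \<xi> \<zeta>") (auto simp: visual_rho_def)

text \<open>The additive error \<open>\<delta>\<close> of the four-point inequality becomes the factor \<open>exp (\<epsilon> * \<delta>)\<close>. The proof
  compares with positive numbers \<open>t = exp (- \<epsilon> * m)\<close>, which covers infinite boundary products.\<close>

lemma visual_rho_ultrametric:
  assumes "0 < \<epsilon>" "\<eta> \<in> gromov_boundary"
  shows "visual_rho w \<epsilon> \<xi> (\<zeta> :: (nat \<Rightarrow> 'a) set)
    \<le> exp (\<epsilon> * \<delta>) * max (visual_rho w \<epsilon> \<xi> \<eta>) (visual_rho w \<epsilon> \<eta> \<zeta>)" (is "_ \<le> _ * ?M")
proof -
  have bound: "visual_rho w \<epsilon> \<xi> \<zeta> \<le> exp (\<epsilon> * \<delta>) * t" if "0 < t" "?M \<le> t" for t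
  proof -
    define m where "m = - ln t / \<epsilon>"
    have t: "t = exp (- \<epsilon> * m)" using that(1) assms(1) by (simp add: m_def)
    have "ereal (m - \<delta>) \<le> boundary_product w \<xi> \<zeta>"
      using that(2) unfolding t
      by (intro boundary_product_ultrametric[OF assms(2)]) (simp_all add: visual_rho_le_exp[OF assms(1), symmetric])
    then have "visual_rho w \<epsilon> \<xi> \<zeta> \<le> exp (- \<epsilon> * (m - \<delta>))" by (simp only: visual_rho_le_exp[OF assms(1)])
    then show ?thesis unfolding t by (simp add: exp_add[symmetric] algebra_simps)
  qed
  show ?thesis
  proof (rule field_le_epsilon)
    fix e :: real assume e: "0 < e"
    have M: "0 \<le> ?M" using visual_rho_nonneg[of w \<epsilon> \<xi> \<eta>] by simp
    have "visual_rho w \<epsilon> \<xi> \<zeta> \<le> exp (\<epsilon> * \<delta>) * (?M + e / exp (\<epsilon> * \<delta>))"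
      using e M by (intro bound) (auto intro: add_nonneg_pos)
    then show "visual_rho w \<epsilon> \<xi> \<zeta> \<le> exp (\<epsilon> * \<delta>) * ?M + e" by (simp add: distrib_left)
  qed
qed

lemma visual_dist_le_rho:
  assumes "\<xi> \<in> gromov_boundary" "(\<zeta> :: (nat \<Rightarrow> 'a) set) \<in> gromov_boundary"
  shows "visual_dist w \<epsilon> \<xi> \<zeta> \<le> visual_rho w \<epsilon> \<xi> \<zeta>"
  unfolding visual_dist_def
proof (rule cInf_lower)
  show "visual_rho w \<epsilon> \<xi> \<zeta> \<in> {\<Sum>i=1..n::nat. visual_rho w \<epsilon> (c (i - 1)) (c i) | n c.
     1 \<le> n \<and> c 0 = \<xi> \<and> c n = \<zeta> \<and> (\<forall>i\<le>n. c i \<in> gromov_boundary)}"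
    using assms by (intro CollectI exI[of _ "1::nat"] exI[of _ "\<lambda>i::nat. if i = 0 then \<xi> else \<zeta>"]) auto
  show "bdd_below {\<Sum>i=1..n::nat. visual_rho w \<epsilon> (c (i - 1)) (c i) | n c.
     1 \<le> n \<and> c 0 = \<xi> \<and> c n = \<zeta> \<and> (\<forall>i\<le>n. c i \<in> gromov_boundary)}"
    by (rule bdd_belowI[of _ 0]) (auto intro: sum_nonneg visual_rho_nonneg)
qed

text \<open>The range allowed for \<open>\<epsilon>\<close> gives \<open>K = exp (\<epsilon> * \<delta>)\<close> with \<open>K\<^sup>2 \<le> exp (2 / 5) < 2\<close>, which is what
  the chain estimate needs.\<close>

lemma visual_rho_le_dist:
  assumes "0 < \<epsilon>" "\<epsilon> * \<delta> \<le> 1 / 5" "\<xi> \<in> gromov_boundary" "(\<zeta> :: (nat \<Rightarrow> 'a) set) \<in> gromov_boundary"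
  shows "visual_rho w \<epsilon> \<xi> \<zeta> \<le> 2 * visual_dist w \<epsilon> \<xi> \<zeta>"
proof -
  have K: "1 \<le> exp (\<epsilon> * \<delta>)" "(exp (\<epsilon> * \<delta>))\<^sup>2 \<le> 2"
  proof -
    show "1 \<le> exp (\<epsilon> * \<delta>)" using assms(1) delta_nonneg by simp
    have "(exp (\<epsilon> * \<delta>))\<^sup>2 = exp (2 * (\<epsilon> * \<delta>))" by (simp add: exp_double)
    also have "\<dots> \<le> exp (2 / 5)" unfolding exp_le_cancel_iff using assms(2) by linarith
    also have "\<dots> \<le> 1 + 2 / 5 + (2 / 5)\<^sup>2" by (rule exp_bound) auto
    also have "\<dots> \<le> (2::real)" by (simp add: power2_eq_square)
    finally show "(exp (\<epsilon> * \<delta>))\<^sup>2 \<le> 2" .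
  qed
  have "visual_rho w \<epsilon> \<xi> \<zeta> / 2 \<le> visual_dist w \<epsilon> \<xi> \<zeta>"
    unfolding visual_dist_def
  proof (rule cInf_greatest)
    show "{\<Sum>i=1..n::nat. visual_rho w \<epsilon> (c (i - 1)) (c i) | n c.
      1 \<le> n \<and> c 0 = \<xi> \<and> c n = \<zeta> \<and> (\<forall>i\<le>n. c i \<in> gromov_boundary)} \<noteq> {}"
      using assms(3,4)
      by (auto intro!: exI[of _ "1::nat"] exI[of _ "\<lambda>i::nat. if i = 0 then \<xi> else \<zeta>"])
  next
    fix s assume "s \<in> {\<Sum>i=1..n::nat. visual_rho w \<epsilon> (c (i - 1)) (c i) | n c.
      1 \<le> n \<and> c 0 = \<xi> \<and> c n = \<zeta> \<and> (\<forall>i\<le>n. c i \<in> gromov_boundary)}"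
    then obtain n c where s: "s = (\<Sum>i=1..n::nat. visual_rho w \<epsilon> (c (i - 1)) (c i))"
      and c: "c 0 = \<xi>" "c n = \<zeta>" "\<And>i. i \<le> n \<Longrightarrow> c i \<in> gromov_boundary" by blast
    have nonneg: "0 \<le> s" unfolding s by (intro sum_nonneg visual_rho_nonneg)
    let ?S = "\<lambda>n. \<Sum>i=1..n::nat. visual_rho w \<epsilon> (c (i - 1)) (c i)"
    have "visual_rho w \<epsilon> (c 0) (c n) \<le> (exp (\<epsilon> * \<delta>))\<^sup>2 * (?S n - ?S 0)"
    proof (rule quasi_ultrametric_chain[where Z = "gromov_boundary :: (nat \<Rightarrow> 'a) set set"
          and S = ?S and n = n])
      show "visual_rho w \<epsilon> x x = 0" if "x \<in> gromov_boundary" for x :: "(nat \<Rightarrow> 'a) set"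
        using boundary_product_self[OF that] by (simp add: visual_rho_def)
    qed (use K c assms(1) in \<open>auto intro: visual_rho_nonneg visual_rho_ultrametric\<close>)
    also have "\<dots> \<le> 2 * s" using K(2) nonneg unfolding s by (simp add: mult_right_mono)
    finally show "visual_rho w \<epsilon> \<xi> \<zeta> / 2 \<le> s" using c by simp
  qed
  then show ?thesis by simp
qed

text \<open>Uniform perfectness in terms of Gromov products: from every boundary point another one
  branches off at every sufficiently large distance from \<open>w\<close>, up to a bounded error.\<close>

definition uniformly_branching :: "'a \<Rightarrow> bool" where
  "uniformly_branching w \<longleftrightarrow> (\<exists>A t\<^sub>0. \<forall>\<xi>\<in>gromov_boundary. \<forall>t\<ge>t\<^sub>0. \<exists>\<zeta>\<in>gromov_boundary.
     ereal (t - A) \<le> boundary_product w \<xi> \<zeta> \<and> boundary_product w \<xi> \<zeta> \<le> ereal (t + A))"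

text \<open>A radius \<open>r\<close> corresponds to the distance \<open>t = - ln r / \<epsilon>\<close> from \<open>w\<close>, and a factor \<open>S\<close> in the radius to
  the additive error \<open>ln S / \<epsilon>\<close> in \<open>t\<close>; the comparison of the visual distance with \<open>visual_rho\<close> costs a
  further factor \<open>2\<close>.\<close>

lemma uniformly_perfect_iff_branching:
  assumes \<epsilon>: "0 < \<epsilon>" "\<epsilon> * \<delta> \<le> 1 / 5"
  shows "uniformly_perfect (gromov_boundary :: (nat \<Rightarrow> 'a) set set) (visual_dist w \<epsilon>) \<longleftrightarrow>
    uniformly_branching w"
proof
  assume "uniformly_perfect (gromov_boundary :: (nat \<Rightarrow> 'a) set set) (visual_dist w \<epsilon>)"
  then obtain S r\<^sub>0 where S: "1 \<le> S" "0 < r\<^sub>0" and perf: "\<And>\<xi> r. \<xi> \<in> gromov_boundary \<Longrightarrow> 0 < r \<Longrightarrow>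
    r \<le> r\<^sub>0 \<Longrightarrow> \<exists>\<zeta>\<in>gromov_boundary. r / S < visual_dist w \<epsilon> \<xi> \<zeta> \<and> visual_dist w \<epsilon> \<xi> (\<zeta> :: (nat \<Rightarrow> 'a) set) \<le> r"
    unfolding uniformly_perfect_def S_uniformly_perfect_def by blast
  define A where "A = max (ln S / \<epsilon>) (ln 2 / \<epsilon>)"
  have "ln S / \<epsilon> \<le> A" "ln 2 / \<epsilon> \<le> A" unfolding A_def by auto
  then have A: "ln S \<le> \<epsilon> * A" "ln 2 \<le> \<epsilon> * A"
    unfolding pos_divide_le_eq[OF \<epsilon>(1)] by (simp_all add: mult.commute)
  have "\<exists>\<zeta>\<in>gromov_boundary. ereal (t - A) \<le> boundary_product w \<xi> \<zeta> \<and>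
      boundary_product w \<xi> \<zeta> \<le> ereal (t + A)"
    if \<xi>: "\<xi> \<in> gromov_boundary" and t: "- ln r\<^sub>0 / \<epsilon> \<le> t" for \<xi> :: "(nat \<Rightarrow> 'a) set" and t
  proof -
    define r where "r = exp (- \<epsilon> * t)"
    have "- ln r\<^sub>0 \<le> \<epsilon> * t" using t \<epsilon>(1) by (simp add: field_simps)
    then have "r \<le> r\<^sub>0" unfolding r_def using S(2) by (metis exp_le_cancel_iff exp_ln minus_le_iff mult_minus_left)
    then obtain \<zeta> where \<zeta>: "\<zeta> \<in> gromov_boundary" "r / S < visual_dist w \<epsilon> \<xi> \<zeta>" "visual_dist w \<epsilon> \<xi> \<zeta> \<le> r"
      using perf[OF \<xi>, of r] unfolding r_def by auto
    have "visual_rho w \<epsilon> \<xi> \<zeta> \<le> 2 * r" using visual_rho_le_dist[OF \<epsilon> \<xi> \<zeta>(1), of w] \<zeta>(3) by simp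
    also have "\<dots> = exp (ln 2 - \<epsilon> * t)" unfolding r_def by (simp add: exp_diff exp_minus field_simps)
    also have "\<dots> \<le> exp (- \<epsilon> * (t - A))" using A(2) by (simp add: algebra_simps)
    finally have lower: "ereal (t - A) \<le> boundary_product w \<xi> \<zeta>" by (simp only: visual_rho_le_exp[OF \<epsilon>(1)])
    have "exp (- \<epsilon> * (t + A)) \<le> exp (- \<epsilon> * t - ln S)" using A(1) by (simp add: algebra_simps)
    also have "\<dots> = r / S" using S(1) unfolding r_def by (simp add: exp_diff)
    also have "\<dots> < visual_rho w \<epsilon> \<xi> \<zeta>" using \<zeta>(2) visual_dist_le_rho[OF \<xi> \<zeta>(1), of w \<epsilon>] by simp
    finally have "boundary_product w \<xi> \<zeta> < ereal (t + A)"
      using visual_rho_le_exp[OF \<epsilon>(1), of w \<xi> \<zeta> "t + A"] by (simp add: not_le[symmetric])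
    with lower \<zeta>(1) show ?thesis by (auto intro: less_imp_le)
  qed
  then show "uniformly_branching w" unfolding uniformly_branching_def by blast
next
  assume "uniformly_branching w"
  then obtain A t\<^sub>0 where branch: "\<And>\<xi> t. \<xi> \<in> gromov_boundary \<Longrightarrow> t\<^sub>0 \<le> t \<Longrightarrow> \<exists>\<zeta>\<in>gromov_boundary.
     ereal (t - A) \<le> boundary_product w \<xi> \<zeta> \<and> boundary_product w \<xi> \<zeta> \<le> ereal (t + A)"
    unfolding uniformly_branching_def by blast
  define A' where "A' = max A 0"
  \<comment> \<open>The window of width \<open>2 * A'\<close> accounts for the exponential; a factor above \<open>2\<close> absorbs the
    comparison of the visual distance with \<open>visual_rho\<close> and makes the lower inequality strict.\<close>
  define S where "S = 3 * exp (2 * (\<epsilon> * A'))"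
  have "1 \<le> exp (2 * (\<epsilon> * A'))" using \<epsilon>(1) by (simp add: A'_def)
  then have "1 \<le> S" unfolding S_def by linarith
  have "\<exists>\<zeta>\<in>gromov_boundary. r / S < visual_dist w \<epsilon> \<xi> \<zeta> \<and> visual_dist w \<epsilon> \<xi> \<zeta> \<le> r"
    if \<xi>: "\<xi> \<in> gromov_boundary" and r: "0 < r" "r \<le> exp (- \<epsilon> * (t\<^sub>0 - A'))" for \<xi> :: "(nat \<Rightarrow> 'a) set" and r
  proof -
    \<comment> \<open>The window around \<open>t\<close> begins at the distance that corresponds to \<open>r\<close>, so that only radii up
      to \<open>r\<close> occur.\<close>
    define t where "t = A' - ln r / \<epsilon>"
    have r_eq: "r = exp (- \<epsilon> * (t - A'))" using r(1) \<epsilon>(1) by (simp add: t_def)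
    have "t\<^sub>0 \<le> t" using r(2) \<epsilon>(1) unfolding r_eq by simp
    then obtain \<zeta> where \<zeta>: "\<zeta> \<in> gromov_boundary" "ereal (t - A) \<le> boundary_product w \<xi> \<zeta>"
      "boundary_product w \<xi> \<zeta> \<le> ereal (t + A)" using branch[OF \<xi>] by blast
    have "ereal (t - A') \<le> boundary_product w \<xi> \<zeta>"
      using \<zeta>(2) by (rule order_trans[rotated]) (simp add: A'_def)
    then have "visual_rho w \<epsilon> \<xi> \<zeta> \<le> r" unfolding r_eq by (simp only: visual_rho_le_exp[OF \<epsilon>(1)])
    then have upper: "visual_dist w \<epsilon> \<xi> \<zeta> \<le> r" using visual_dist_le_rho[OF \<xi> \<zeta>(1), of w \<epsilon>] by simp
    obtain b where b: "boundary_product w \<xi> \<zeta> = ereal b" "b \<le> t + A'"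
      using \<zeta>(3) boundary_product_nonneg[of w \<xi> \<zeta>] by (cases "boundary_product w \<xi> \<zeta>") (auto simp: A'_def)
    have "\<epsilon> * b \<le> \<epsilon> * (t + A')" using b(2) \<epsilon>(1) by (intro mult_left_mono) auto
    then have "exp (- \<epsilon> * (t + A')) \<le> visual_rho w \<epsilon> \<xi> \<zeta>"
      using b(1) by (simp add: visual_rho_def)
    moreover have "exp (- \<epsilon> * (t + A')) = 3 * (r / S)"
      unfolding r_eq S_def by (simp add: exp_add[symmetric] exp_minus field_simps)
    moreover have "0 < r / S" using r \<open>1 \<le> S\<close> by simp
    ultimately have "r / S < visual_dist w \<epsilon> \<xi> \<zeta>"
      using visual_rho_le_dist[OF \<epsilon> \<xi> \<zeta>(1), of w] by linarith
    with upper \<zeta>(1) show ?thesis by blast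
  qed
  with \<open>1 \<le> S\<close> show "uniformly_perfect (gromov_boundary :: (nat \<Rightarrow> 'a) set set) (visual_dist w \<epsilon>)"
    unfolding uniformly_perfect_def S_uniformly_perfect_def
    by (intro exI[of _ S] conjI exI[of _ "exp (- \<epsilon> * (t\<^sub>0 - A'))"]) auto
qed

section \<open>Poles\<close>

text \<open>If \<open>(w|\<xi>)\<^sub>q\<close> is small, then \<open>q\<close> is close to a geodesic from \<open>w\<close> to \<open>\<xi>\<close>, and so is every point \<open>x\<close>
  near \<open>q\<close>: the direction of \<open>\<xi>\<close> agrees with that of \<open>x\<close> almost up to \<open>x\<close>.\<close>

lemma gp_near_boundary_point:
  assumes \<xi>: "\<xi> \<in> gromov_boundary" "u \<in> \<xi>" and "dist x q \<le> L"
    and freq: "\<exists>\<^sub>F n in sequentially. gp q w (u n :: 'a) \<le> a"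
    and y: "y \<in> \<xi>"
  shows "\<forall>\<^sub>F i in sequentially. dist x w - (2 * L + a + \<delta>) \<le> gp w x (y i)"
proof -
  have "dist x w - 2 * L - a \<le> gp w x (u n)" if "gp q w (u n) \<le> a" for n
  proof -
    have "gp q w (u n) = dist q w - gp w q (u n)" by (rule gp_swap_base)
    moreover have "gp w q (u n) \<le> gp w x (u n) + dist q x" by (rule gp_lipschitz)
    moreover have "dist x w \<le> dist x q + dist q w" by (rule dist_triangle)
    ultimately show ?thesis using that assms(3) dist_commute[of x q] by linarith
  qed
  with freq have "\<exists>\<^sub>F n in sequentially. dist x w - 2 * L - a \<le> gp w x (u n)"
    by (rule frequently_elim1)
  from frequently_gp_imp_eventually[OF \<xi> y this] show ?thesis by (simp add: algebra_simps)
qed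

text \<open>A point \<open>q\<close> of a line joining two boundary points lies near the geodesic from \<open>w\<close> to at least
  one of them. Hence a pole at infinity serves as well as one at \<open>w\<close>.\<close>

lemma pole_at_base:
  assumes "has_pole TYPE('a)"
  obtains M where "\<And>x. \<exists>\<xi>\<in>gromov_boundary. \<forall>y\<in>\<xi>. \<forall>\<^sub>F i in sequentially. dist x w - M \<le> gp w x (y i :: 'a)"
proof -
  obtain L pt where "pt \<in> gromov_closure" and L: "\<And>x::'a. \<exists>v\<in>gromov_boundary. \<exists>G.
      geodesic_connecting pt v G \<and> in_nbhd L {x} G"
    using assms unfolding has_pole_def has_L_pole_def by metis
  consider (inner) p where "pt = Inl p" | (ideal) u where "pt = Inr u" "u \<in> gromov_boundary"
    using \<open>pt \<in> gromov_closure\<close> unfolding gromov_closure_def by (auto elim: PlusE)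
  then show ?thesis
  proof cases
    case inner
    show ?thesis
    proof (rule that)
      fix x
      obtain v \<gamma> s where v: "v \<in> gromov_boundary" "(\<lambda>n. \<gamma> (real n)) \<in> v"
        and \<gamma>: "geodesic_on {0..} \<gamma>" "\<gamma> 0 = p" and s: "0 \<le> s" "dist x (\<gamma> s) \<le> L"
        using L[of x] unfolding inner in_nbhd_def by auto
      have "\<forall>\<^sub>F n in sequentially. gp (\<gamma> s) w (\<gamma> (real n)) \<le> dist w p"
        using eventually_ge_at_top[of "nat \<lceil>s\<rceil>"]
      proof eventually_elim
        case (elim n)
        then have "s \<le> real n" by linarith
        then have "gp (\<gamma> s) p (\<gamma> (real n)) = 0"
          using gp_geodesic[OF \<gamma>(1), of 0 s "real n"] s(1) \<gamma>(2) by simp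
        then show ?case using gp_lipschitz[of "\<gamma> s" w "\<gamma> (real n)" p] by linarith
      qed
      then have "\<exists>\<^sub>F n in sequentially. gp (\<gamma> s) w (\<gamma> (real n)) \<le> dist w p"
        by (rule eventually_frequently[OF sequentially_bot])
      then show "\<exists>\<xi>\<in>gromov_boundary. \<forall>y\<in>\<xi>. \<forall>\<^sub>F i in sequentially.
          dist x w - (2 * L + dist w p + \<delta>) \<le> gp w x (y i)"
        using gp_near_boundary_point[OF v s(2)] by (intro bexI[OF _ v(1)] ballI)
    qed
  next
    case ideal
    show ?thesis
    proof (rule that)
      fix x
      obtain v \<gamma> s where v: "v \<in> gromov_boundary" "(\<lambda>n. \<gamma> (real n)) \<in> v"
        and u: "(\<lambda>n. \<gamma> (- real n)) \<in> u"
        and \<gamma>: "geodesic_on UNIV \<gamma>" and s: "dist x (\<gamma> s) \<le> L"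
        using L[of x] unfolding ideal in_nbhd_def by auto
      have "\<forall>\<^sub>F n in sequentially. gp (\<gamma> s) w (\<gamma> (- real n)) \<le> \<delta> \<or> gp (\<gamma> s) w (\<gamma> (real n)) \<le> \<delta>"
        using eventually_ge_at_top[of "nat \<lceil>\<bar>s\<bar>\<rceil>"]
      proof eventually_elim
        case (elim n)
        then have "\<bar>s\<bar> \<le> real n" by linarith
        then have "gp (\<gamma> s) (\<gamma> (- real n)) (\<gamma> (real n)) = 0"
          using gp_geodesic[OF \<gamma>, of "- real n" s "real n"] by simp
        then show ?case
          using four_point[of "\<gamma> s" "\<gamma> (- real n)" w "\<gamma> (real n)"]
            gp_commute[of "\<gamma> s" "\<gamma> (- real n)" w] by linarith
      qed
      then have "\<exists>\<^sub>F n in sequentially. gp (\<gamma> s) w (\<gamma> (- real n)) \<le> \<delta> \<or> gp (\<gamma> s) w (\<gamma> (real n)) \<le> \<delta>"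
        by (rule eventually_frequently[OF sequentially_bot])
      then consider "\<exists>\<^sub>F n in sequentially. gp (\<gamma> s) w (\<gamma> (- real n)) \<le> \<delta>"
        | "\<exists>\<^sub>F n in sequentially. gp (\<gamma> s) w (\<gamma> (real n)) \<le> \<delta>"
        unfolding frequently_disj_iff by (elim disjE)
      then show "\<exists>\<xi>\<in>gromov_boundary. \<forall>y\<in>\<xi>. \<forall>\<^sub>F i in sequentially.
          dist x w - (2 * L + \<delta> + \<delta>) \<le> gp w x (y i)"
      proof cases
        case 1
        show ?thesis
          using gp_near_boundary_point[OF ideal(2) u s 1] by (intro bexI[OF _ ideal(2)] ballI)
      next
        case 2
        show ?thesis
          using gp_near_boundary_point[OF v s 2] by (intro bexI[OF _ v(1)] ballI)
      qed
    qed
  qed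
qed

section \<open>Stability of quasi-geodesics\<close>

text \<open>Halving a path repeatedly: the four-point inequality is applied only logarithmically many
  times, which expresses the exponential divergence of geodesics.\<close>

lemma gp_along_path:
  fixes c :: "nat \<Rightarrow> 'a"
  assumes "l \<le> m" "m - l \<le> 2 ^ k" "0 \<le> r"
    and far: "\<And>i. l \<le> i \<Longrightarrow> i \<le> m \<Longrightarrow> b \<le> dist (c i) p"
    and step: "\<And>i. l \<le> i \<Longrightarrow> i < m \<Longrightarrow> dist (c i) (c (Suc i)) \<le> r"
  shows "b - r - real k * \<delta> \<le> gp p (c l) (c m)"
  using assms(1,2) far step
proof (induction k arbitrary: l m)
  case 0
  then consider "m = l" | "m = Suc l" by force
  then show ?case
  proof cases
    case 1
    then show ?thesis using 0 assms(3) by force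
  next
    case 2
    then have "dist (c l) (c m) \<le> r" "b \<le> dist (c l) p" using 0 by auto
    then show ?thesis using gp_lipschitz[of p "c l" "c l" "c m"] gp_commute[of p "c l" "c m"] by simp
  qed
next
  case (Suc k)
  define n where "n = min m (l + 2 ^ k)"
  have n: "l \<le> n" "n \<le> m" "n - l \<le> 2 ^ k" "m - n \<le> 2 ^ k" using Suc.prems(1,2) unfolding n_def by auto
  have "b - r - real k * \<delta> \<le> gp p (c l) (c n)"
    by (rule Suc.IH[OF n(1,3)]) (use Suc.prems n in auto)
  moreover have "b - r - real k * \<delta> \<le> gp p (c n) (c m)"
    by (rule Suc.IH[OF n(2,4)]) (use Suc.prems n in auto)
  ultimately show ?case using four_point2[of "b - r - real k * \<delta>" p "c l" "c n" "c m"]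
    by (simp add: algebra_simps)
qed

end

text \<open>The logarithm is bounded by each of its tangents; the one of slope \<open>e\<close> below is flat enough for
  the resulting coefficient of \<open>D\<close> to be at most \<open>1 / 2\<close>.\<close>

lemma bounded_of_le_log:
  fixes \<alpha> \<beta> \<kappa> \<mu> :: real
  assumes "0 \<le> \<beta>" "0 < \<kappa>" "0 < \<mu>"
  obtains B where "0 \<le> B" "\<And>D. 0 \<le> D \<Longrightarrow> D \<le> \<alpha> + \<beta> * log 2 (\<kappa> * D + \<mu>) \<Longrightarrow> D \<le> B"
proof -
  define e where "e = ln 2 / (2 * (\<beta> + 1) * \<kappa>)"
  have e: "0 < e" unfolding e_def using assms by simp
  define Y where "Y = \<beta> / ln 2 * (e * \<mu> - 1 - ln e)"
  define B where "B = \<bar>2 * \<alpha> + 2 * Y\<bar>"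
  have "D \<le> B" if D: "0 \<le> D" "D \<le> \<alpha> + \<beta> * log 2 (\<kappa> * D + \<mu>)" for D
  proof -
    have pos: "0 < \<kappa> * D + \<mu>" using assms D(1) by (simp add: add_nonneg_pos)
    have "ln (\<kappa> * D + \<mu>) = ln (e * (\<kappa> * D + \<mu>)) - ln e" using e pos by (simp add: ln_mult)
    also have "\<dots> \<le> e * (\<kappa> * D + \<mu>) - 1 - ln e" using ln_le_minus_one[of "e * (\<kappa> * D + \<mu>)"] e pos by simp
    finally have "\<beta> / ln 2 * ln (\<kappa> * D + \<mu>) \<le> \<beta> / ln 2 * (e * (\<kappa> * D + \<mu>) - 1 - ln e)"
      using assms(1) by (intro mult_left_mono) auto
    also have "\<dots> = \<beta> / ln 2 * (e * \<kappa>) * D + Y" unfolding Y_def by (simp add: algebra_simps)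
    also have "\<beta> / ln 2 * (e * \<kappa>) = \<beta> / (2 * (\<beta> + 1))" unfolding e_def using assms(2) by simp
    also have "\<beta> / (2 * (\<beta> + 1)) * D \<le> 1 / 2 * D"
      using assms(1) D(1) by (intro mult_right_mono) (simp_all add: field_simps)
    finally have "\<beta> * log 2 (\<kappa> * D + \<mu>) \<le> 1 / 2 * D + Y" by (simp add: log_def)
    then show ?thesis using D(2) unfolding B_def by linarith
  qed
  moreover have "0 \<le> B" unfolding B_def by simp
  ultimately show thesis using that by blast
qed

definition quasi_geodesic :: "real \<Rightarrow> real \<Rightarrow> nat \<Rightarrow> (nat \<Rightarrow> 'a::metric_space) \<Rightarrow> bool" where
  "quasi_geodesic K C N c \<longleftrightarrow> (\<forall>i\<le>N. \<forall>j\<le>N. \<bar>real i - real j\<bar> / K - C \<le> dist (c i) (c j) \<and>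
     dist (c i) (c j) \<le> K * \<bar>real i - real j\<bar> + C)"

context gromov_space
begin

text \<open>Let \<open>D\<close> be the largest distance from the path to a point \<open>p\<close> of the geodesic. Leave the geodesic
  at distance \<open>2 * D\<close> on either side of \<open>p\<close> and follow the path from one side to the other: this
  detour of length linear in \<open>D\<close> stays at distance \<open>D\<close> from \<open>p\<close>, so \<open>D\<close> is at most logarithmic in
  \<open>D\<close>.\<close>

lemma geodesic_near_quasi_geodesic:
  assumes K: "1 \<le> K" and C: "0 \<le> C"
  obtains B where "0 \<le> B"
    "\<And>N (c :: nat \<Rightarrow> 'a) \<gamma> l s. quasi_geodesic K C N c \<Longrightarrow> geodesic_on {0..l} \<gamma> \<Longrightarrow> \<gamma> 0 = c 0 \<Longrightarrow>
      \<gamma> l = c N \<Longrightarrow> s \<in> {0..l} \<Longrightarrow> \<exists>i\<le>N. dist (\<gamma> s) (c i) \<le> B"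
proof -
  have KC: "0 < K * C + 1" using K C by (simp add: add_nonneg_pos)
  obtain B where B: "0 \<le> B"
    "\<And>D. 0 \<le> D \<Longrightarrow> D \<le> K + C + 3 * \<delta> + \<delta> * log 2 (6 * K * D + (K * C + 1)) \<Longrightarrow> D \<le> B"
    using bounded_of_le_log[OF delta_nonneg _ KC, of "6 * K" "K + C + 3 * \<delta>"] K by auto
  have "\<exists>i\<le>N. dist (\<gamma> s) (c i) \<le> B"
    if qg: "quasi_geodesic K C N c" and \<gamma>: "geodesic_on {0..l} \<gamma>" "\<gamma> 0 = c 0" "\<gamma> l = c N"
      and s: "s \<in> {0..l}" for N and c :: "nat \<Rightarrow> 'a" and \<gamma> l s
  proof -
    have iso: "dist (\<gamma> u) (\<gamma> v) = \<bar>u - v\<bar>" if "0 \<le> u" "u \<le> l" "0 \<le> v" "v \<le> l" for u v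
      using \<gamma>(1) that unfolding geodesic_on_def by simp
    define P where "P = c ` {..N}"
    have P: "finite P" "P \<noteq> {}" unfolding P_def by auto
    have "continuous_on {0..l} \<gamma>"
      by (rule continuous_onI) (auto simp: iso dist_real_def intro!: exI[of _ "_::real"] less_imp_le)
    then have "continuous_on {0..l} (\<lambda>u. infdist (\<gamma> u) P)" by (rule continuous_on_infdist)
    then obtain s0 where s0: "s0 \<in> {0..l}" "\<And>u. u \<in> {0..l} \<Longrightarrow> infdist (\<gamma> u) P \<le> infdist (\<gamma> s0) P"
      using continuous_attains_sup[of "{0..l}"] s by (metis compact_Icc empty_iff)
    define D where "D = infdist (\<gamma> s0) P"
    have D: "0 \<le> D" unfolding D_def by (rule infdist_nonneg)
    have near: "\<exists>i\<le>N. dist (\<gamma> u) (c i) \<le> D" if "u \<in> {0..l}" for u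
    proof -
      have "infdist (\<gamma> u) P = Min (dist (\<gamma> u) ` P)" using P by (simp add: infdist_notempty cInf_eq_Min)
      then have "infdist (\<gamma> u) P \<in> dist (\<gamma> u) ` P" using P Min_in[of "dist (\<gamma> u) ` P"] by simp
      then obtain y where "y \<in> P" "infdist (\<gamma> u) P = dist (\<gamma> u) y" by blast
      with s0(2)[OF that] show ?thesis unfolding P_def D_def by auto
    qed
    have far: "D \<le> dist (c i) (\<gamma> s0)" if "i \<le> N" for i
      using infdist_le[of "c i" P "\<gamma> s0"] that unfolding P_def D_def by (simp add: dist_commute)
    have side: "\<exists>i\<le>N. dist (\<gamma> u) (c i) \<le> D \<and> D \<le> gp (\<gamma> s0) (\<gamma> u) (c i)"
      if u: "u \<in> {0..l}" "\<bar>u - s0\<bar> = 2 * D \<or> u = 0 \<or> u = l" for u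
      using u(2)
    proof (elim disjE)
      assume *: "\<bar>u - s0\<bar> = 2 * D"
      obtain i where i: "i \<le> N" "dist (\<gamma> u) (c i) \<le> D" using near[OF u(1)] by blast
      have "dist (\<gamma> u) (\<gamma> s0) = 2 * D" using iso[of u s0] u(1) s0(1) * by simp
      with i far[OF i(1)] two_gp[of "\<gamma> s0" "\<gamma> u" "c i"] show ?thesis by (intro exI[of _ i]) linarith
    next
      assume "u = 0"
      then show ?thesis using far[of 0] \<gamma>(2) D by (intro exI[of _ 0]) simp
    next
      assume "u = l"
      then show ?thesis using far[of N] \<gamma>(3) D by (intro exI[of _ N]) simp
    qed
    \<comment> \<open>Where the geodesic is too short to go back or forth by \<open>2 * D\<close>, it ends on the path itself.\<close>
    define u where "u = max 0 (s0 - 2 * D)"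
    define v where "v = min l (s0 + 2 * D)"
    have uv: "u \<in> {0..l}" "v \<in> {0..l}" "u \<le> s0" "s0 \<le> v" "v - u \<le> 4 * D"
      using s0(1) D unfolding u_def v_def by auto
    have u': "\<bar>u - s0\<bar> = 2 * D \<or> u = 0 \<or> u = l" and v': "\<bar>v - s0\<bar> = 2 * D \<or> v = 0 \<or> v = l"
      using D unfolding u_def v_def by linarith+
    obtain i where i: "i \<le> N" "dist (\<gamma> u) (c i) \<le> D" "D \<le> gp (\<gamma> s0) (\<gamma> u) (c i)"
      using side[OF uv(1) u'] by blast
    obtain j where j: "j \<le> N" "dist (\<gamma> v) (c j) \<le> D" "D \<le> gp (\<gamma> s0) (\<gamma> v) (c j)"
      using side[OF uv(2) v'] by blast
    define R where "R = K * (6 * D + C)"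
    have R: "0 \<le> R" unfolding R_def using K C D by simp
    have "dist (\<gamma> u) (\<gamma> v) \<le> 4 * D" using iso[of u v] uv by simp
    then have "dist (c i) (c j) \<le> 6 * D"
      using i(2) j(2) dist_triangle[of "c i" "c j" "\<gamma> u"] dist_triangle[of "\<gamma> u" "c j" "\<gamma> v"]
        dist_commute[of "c i" "\<gamma> u"] by linarith
    moreover have "\<bar>real i - real j\<bar> / K - C \<le> dist (c i) (c j)"
      using qg i(1) j(1) unfolding quasi_geodesic_def by blast
    ultimately have "\<bar>real i - real j\<bar> / K \<le> 6 * D + C" by linarith
    then have ij: "\<bar>real i - real j\<bar> \<le> R" unfolding R_def using K by (simp add: field_simps)
    \<comment> \<open>Enough halvings for the at most \<open>R\<close> steps of the path between \<open>c i\<close> and \<open>c j\<close>; the \<open>+ 1\<close> keeps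
      the logarithm nonnegative.\<close>
    define k where "k = nat \<lceil>log 2 (R + 1)\<rceil>"
    have log0: "0 \<le> log 2 (R + 1)" using R by simp
    have k: "log 2 (R + 1) \<le> real k" "real k \<le> log 2 (R + 1) + 1" unfolding k_def using log0 by linarith+
    have "R + 1 = 2 powr (log 2 (R + 1))" using R by simp
    also have "\<dots> \<le> 2 powr (real k)" using k(1) by simp
    also have "\<dots> = real (2 ^ k)" by (simp add: powr_realpow)
    finally have "\<bar>real i - real j\<bar> \<le> real (2 ^ k)" using ij by linarith
    then have pow: "j - i \<le> 2 ^ k" "i - j \<le> 2 ^ k" by linarith+
    have step: "dist (c n) (c (Suc n)) \<le> K + C" if "n < N" for n
    proof -
      have "dist (c n) (c (Suc n)) \<le> K * \<bar>real n - real (Suc n)\<bar> + C"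
        using qg that unfolding quasi_geodesic_def by (meson Suc_leI less_imp_le)
      then show ?thesis by simp
    qed
    have "D - (K + C) - real k * \<delta> \<le> gp (\<gamma> s0) (c i) (c j)"
    proof (cases "i \<le> j")
      case True
      then show ?thesis using j(1) far step pow K C by (intro gp_along_path) auto
    next
      case False
      then have "D - (K + C) - real k * \<delta> \<le> gp (\<gamma> s0) (c j) (c i)"
        using i(1) far step pow K C by (intro gp_along_path) auto
      then show ?thesis by (simp add: gp_commute)
    qed
    moreover have "0 \<le> real k * \<delta>" using delta_nonneg by simp
    ultimately have "D - (K + C) - real k * \<delta> - 2 * \<delta> \<le> gp (\<gamma> s0) (\<gamma> u) (\<gamma> v)"
      using i(3) j(3) K C gp_commute[of "\<gamma> s0" "\<gamma> v" "c j"] by (intro four_point3[of _ _ _ "c i" "c j"]) linarith+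
    also have "\<dots> = 0" using gp_geodesic[OF \<gamma>(1) uv(1) s0(1) uv(2)] uv by simp
    finally have "D \<le> K + C + 2 * \<delta> + real k * \<delta>" by simp
    also have "real k * \<delta> \<le> (log 2 (R + 1) + 1) * \<delta>" using k(2) delta_nonneg by (rule mult_right_mono)
    finally have "D \<le> K + C + 3 * \<delta> + \<delta> * log 2 (R + 1)" by (simp add: algebra_simps)
    also have "R + 1 = 6 * K * D + (K * C + 1)" unfolding R_def by (simp add: algebra_simps)
    finally have "D \<le> B" by (rule B(2)[OF D])
    with near[OF s] show ?thesis by force
  qed
  with B(1) show thesis by (rule that)
qed

text \<open>Some point of the geodesic is close to the part of the path before \<open>c i\<close>, while the point one unit
  further along is close to the part after \<open>c i\<close>. These two places of the path are close to each other, hence so are their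
  indices, between which \<open>i\<close> lies.\<close>

lemma gp_on_quasi_geodesic_bounded:
  assumes K: "1 \<le> K" and C: "0 \<le> C"
  obtains B where "\<And>N (c :: nat \<Rightarrow> 'a) i. quasi_geodesic K C N c \<Longrightarrow> i \<le> N \<Longrightarrow> gp (c i) (c 0) (c N) \<le> B"
proof -
  obtain B where B: "0 \<le> B"
    "\<And>N (c :: nat \<Rightarrow> 'a) \<gamma> l s. quasi_geodesic K C N c \<Longrightarrow> geodesic_on {0..l} \<gamma> \<Longrightarrow> \<gamma> 0 = c 0 \<Longrightarrow>
      \<gamma> l = c N \<Longrightarrow> s \<in> {0..l} \<Longrightarrow> \<exists>i\<le>N. dist (\<gamma> s) (c i) \<le> B"
    using geodesic_near_quasi_geodesic[OF K C] by blast
  have "gp (c i) (c 0) (c N) \<le> K * (K * (2 * B + 1 + C)) + C + B"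
    if qg: "quasi_geodesic K C N c" and i: "i \<le> N" for N and c :: "nat \<Rightarrow> 'a" and i
  proof -
    let ?l = "dist (c 0) (c N)"
    obtain \<gamma> where \<gamma>: "geodesic_on {0..?l} \<gamma>" "\<gamma> 0 = c 0" "\<gamma> ?l = c N"
      using geodesic_space_obtains geodesic by metis
    define A where "A = {s \<in> {0..?l}. \<exists>j\<le>i. dist (\<gamma> s) (c j) \<le> B}"
    have A0: "0 \<in> A" unfolding A_def using \<gamma>(2) B(1) by auto
    have A_bdd: "bdd_above A" unfolding A_def by (rule bdd_aboveI[of _ ?l]) auto
    obtain s where s: "s \<in> A" "Sup A - 1 < s" using less_cSupE[of "Sup A - 1" A] A0 by auto
    have not_A: "s + 1 \<notin> A" using cSup_upper[OF _ A_bdd, of "s + 1"] s(2) by auto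
    obtain j where j: "j \<le> i" "dist (\<gamma> s) (c j) \<le> B" using s(1) unfolding A_def by blast
    define t where "t = min ?l (s + 1)"
    have st: "s \<in> {0..?l}" "t \<in> {0..?l}" "\<bar>s - t\<bar> \<le> 1" using s(1) unfolding A_def t_def by auto
    have "\<exists>k\<ge>i. k \<le> N \<and> dist (\<gamma> t) (c k) \<le> B"
    proof (cases "t = ?l")
      case True
      then show ?thesis using \<gamma>(3) i B(1) by (intro exI[of _ N]) simp
    next
      case False
      then have "t \<notin> A" using not_A unfolding t_def by (auto simp: min_def split: if_splits)
      moreover obtain k where "k \<le> N" "dist (\<gamma> t) (c k) \<le> B" using B(2)[OF qg \<gamma> st(2)] by blast
      ultimately show ?thesis
        using st(2) nat_le_linear[of i k] unfolding A_def by (intro exI[of _ k]) auto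
    qed
    then obtain k where k: "i \<le> k" "k \<le> N" "dist (\<gamma> t) (c k) \<le> B" by blast
    have "dist (\<gamma> s) (\<gamma> t) \<le> 1" using \<gamma>(1) st unfolding geodesic_on_def by simp
    then have "dist (c j) (c k) \<le> 2 * B + 1"
      using j(2) k(3) dist_triangle[of "c j" "c k" "\<gamma> s"] dist_triangle[of "\<gamma> s" "c k" "\<gamma> t"]
        dist_commute[of "c j" "\<gamma> s"] by linarith
    moreover have "\<bar>real j - real k\<bar> / K - C \<le> dist (c j) (c k)"
      using qg j(1) k unfolding quasi_geodesic_def by (meson order_trans)
    ultimately have "\<bar>real j - real k\<bar> / K \<le> 2 * B + 1 + C" by linarith
    then have "\<bar>real j - real k\<bar> \<le> K * (2 * B + 1 + C)" using K by (simp add: field_simps)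
    then have "\<bar>real i - real j\<bar> \<le> K * (2 * B + 1 + C)" using j(1) k(1) by linarith
    then have "K * \<bar>real i - real j\<bar> \<le> K * (K * (2 * B + 1 + C))" using K by (intro mult_left_mono) auto
    moreover have "dist (c i) (c j) \<le> K * \<bar>real i - real j\<bar> + C"
      using qg j(1) i unfolding quasi_geodesic_def by (meson order_trans)
    moreover have "gp (\<gamma> s) (c 0) (c N) = 0"
      using gp_geodesic[OF \<gamma>(1), of 0 s ?l] st(1) \<gamma>(2,3) by simp
    ultimately show ?thesis
      using gp_lipschitz_base[of "c i" "c 0" "c N" "\<gamma> s"] j(2) dist_triangle[of "c i" "\<gamma> s" "c j"]
        dist_commute[of "\<gamma> s" "c j"] by linarith
  qed
  then show thesis by (rule that)
qed

text \<open>If \<open>(a|b)\<^sub>x\<close> is bounded, then \<open>x\<close> is close to a point of a geodesic from \<open>a\<close> to \<open>b\<close>. The image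
  of that geodesic, sampled at integer times, is a quasi-geodesic.\<close>

lemma quasi_isometric_embedding_gp_bounded:
  fixes f :: "'a \<Rightarrow> 'a"
  assumes f: "quasi_isometric_embedding K C f"
  obtains B where "\<And>x a b. gp x a b \<le> R \<Longrightarrow> gp (f x) (f a) (f b) \<le> B"
proof -
  have K: "1 \<le> K" and C: "0 \<le> C" and lower: "\<And>x y. dist x y / K - C \<le> dist (f x) (f y)"
    and upper: "\<And>x y. dist (f x) (f y) \<le> K * dist x y + C"
    using f unfolding quasi_isometric_embedding_def by auto
  have C': "0 \<le> K + C" using K C by simp
  obtain B where B: "\<And>N (c :: nat \<Rightarrow> 'a) i. quasi_geodesic K (K + C) N c \<Longrightarrow> i \<le> N \<Longrightarrow> gp (c i) (c 0) (c N) \<le> B"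
    using gp_on_quasi_geodesic_bounded[OF K C'] by blast
  have "gp (f x) (f a) (f b) \<le> B + (K * (R + 2 * \<delta> + 1) + C)" if R: "gp x a b \<le> R" for x a b
  proof -
    let ?l = "dist a b"
    obtain \<gamma> where \<gamma>: "geodesic_on {0..?l} \<gamma>" "\<gamma> 0 = a" "\<gamma> ?l = b"
      using geodesic_space_obtains geodesic by metis
    have iso: "dist (\<gamma> u) (\<gamma> v) = \<bar>u - v\<bar>" if "0 \<le> u" "u \<le> ?l" "0 \<le> v" "v \<le> ?l" for u v
      using \<gamma>(1) that unfolding geodesic_on_def by simp
    define s where "s = gp a x b"
    have s: "0 \<le> s" "s \<le> ?l" "s \<le> dist x a"
      using gp_nonneg gp_le_dist1[of a x b] gp_le_dist2[of a x b] unfolding s_def by (auto simp: dist_commute)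
    have "gp a b (\<gamma> s) = s" using gp_geodesic_start[OF \<gamma>(1), of 0 ?l s] s \<gamma> by simp
    then have "s - \<delta> \<le> gp a x (\<gamma> s)" by (intro four_point2[of s a x b]) (simp_all add: s_def)
    moreover have "dist (\<gamma> s) a = s" using iso[of s 0] s \<gamma>(2) by simp
    moreover have "gp x a b = dist x a - s" unfolding s_def by (rule gp_swap_base)
    ultimately have x: "dist x (\<gamma> s) \<le> R + 2 * \<delta>" using R dist_eq_gp[of x "\<gamma> s" a] by linarith
    define \<tau> where "\<tau> = (\<lambda>i::nat. min (real i) ?l)"
    define N where "N = nat \<lceil>?l\<rceil>"
    have N: "?l \<le> real N" "real N < ?l + 1"
    proof -
      show "?l \<le> real N" unfolding N_def by linarith
      have "real N = of_int \<lceil>?l\<rceil>" unfolding N_def by (simp add: order_trans[OF _ le_of_int_ceiling])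
      then show "real N < ?l + 1" by linarith
    qed
    define c where "c = (\<lambda>i. f (\<gamma> (\<tau> i)))"
    have \<tau>: "0 \<le> \<tau> i" "\<tau> i \<le> ?l" for i unfolding \<tau>_def by auto
    have "quasi_geodesic K (K + C) N c"
      unfolding quasi_geodesic_def
    proof (intro allI impI)
      fix i j assume "i \<le> N" "j \<le> N"
      then have "real i < ?l + 1" "real j < ?l + 1" using N(2) by linarith+
      then have ij: "\<bar>real i - real j\<bar> - 1 \<le> dist (\<gamma> (\<tau> i)) (\<gamma> (\<tau> j))"
        "dist (\<gamma> (\<tau> i)) (\<gamma> (\<tau> j)) \<le> \<bar>real i - real j\<bar>"
        unfolding iso[OF \<tau> \<tau>] unfolding \<tau>_def by linarith+
      have "(\<bar>real i - real j\<bar> - 1) / K \<le> dist (\<gamma> (\<tau> i)) (\<gamma> (\<tau> j)) / K"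
        using ij(1) K by (intro divide_right_mono) auto
      moreover have "(\<bar>real i - real j\<bar> - 1) / K = \<bar>real i - real j\<bar> / K - 1 / K" by (rule diff_divide_distrib)
      moreover have "1 / K \<le> K" using K by (simp add: divide_le_eq mult_ge1_I)
      moreover have "K * dist (\<gamma> (\<tau> i)) (\<gamma> (\<tau> j)) \<le> K * \<bar>real i - real j\<bar>"
        using ij(2) K by (intro mult_left_mono) auto
      ultimately show "\<bar>real i - real j\<bar> / K - (K + C) \<le> dist (c i) (c j) \<and>
          dist (c i) (c j) \<le> K * \<bar>real i - real j\<bar> + (K + C)"
        using lower[of "\<gamma> (\<tau> i)" "\<gamma> (\<tau> j)"] upper[of "\<gamma> (\<tau> i)" "\<gamma> (\<tau> j)"] K unfolding c_def by linarith
    qed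
    moreover define n where "n = nat \<lfloor>s\<rfloor>"
    have n: "n \<le> N" "\<bar>s - \<tau> n\<bar> \<le> 1" using s unfolding n_def N_def \<tau>_def by linarith+
    ultimately have "gp (c n) (c 0) (c N) \<le> B" using B by blast
    moreover have "c 0 = f a" "c N = f b" unfolding c_def \<tau>_def using \<gamma>(2,3) N(1) by simp_all
    moreover have "dist x (\<gamma> (\<tau> n)) \<le> R + 2 * \<delta> + 1"
      using x n(2) iso[OF s(1,2) \<tau>, of n] dist_triangle[of x "\<gamma> (\<tau> n)" "\<gamma> s"] by linarith
    then have "K * dist x (\<gamma> (\<tau> n)) \<le> K * (R + 2 * \<delta> + 1)" using K by (intro mult_left_mono) auto
    then have "dist (f x) (c n) \<le> K * (R + 2 * \<delta> + 1) + C"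
      using upper[of x "\<gamma> (\<tau> n)"] unfolding c_def by linarith
    ultimately show ?thesis using gp_lipschitz_base[of "f x" "f a" "f b" "c n"] by simp
  qed
  then show thesis by (rule that)
qed

section \<open>Uniform branching implies boundary rigidity\<close>

text \<open>Representatives whose images are not Gromov sequences contribute nothing to the union that
  defines \<open>boundary_map f \<xi>\<close>. As this union is the nonempty class \<open>\<xi>\<close>, some representative has its image
  in \<open>\<xi>\<close>, and it suffices to work with that one.\<close>

lemma boundary_map_fixed_representative:
  fixes f :: "'a \<Rightarrow> 'a"
  assumes \<xi>: "\<xi> \<in> gromov_boundary" and "boundary_map f \<xi> = \<xi>"
  obtains u where "u \<in> \<xi>" "f \<circ> u \<in> \<xi>"
proof -
  obtain z where "z \<in> \<xi>" using boundary_nonempty[OF \<xi>] by blast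
  then have "z \<in> boundary_map f \<xi>" using assms(2) by simp
  then obtain u where u: "u \<in> \<xi>" "(f \<circ> u, z) \<in> gromov_rel" unfolding boundary_map_def by blast
  have "f \<circ> u \<in> \<xi>" using boundary_class[OF \<xi> \<open>z \<in> \<xi>\<close>] gromov_rel_sym[OF u(2)] by blast
  with u(1) show thesis by (rule that)
qed

text \<open>A point \<open>x\<close> far from \<open>w\<close> is a coarse centre of the three points \<open>w\<close>, \<open>a\<close>, \<open>b\<close>, where \<open>a\<close> and
  \<open>b\<close> are far out towards two boundary points that branch at distance about \<open>dist x w\<close> from \<open>w\<close>. By
  stability of quasi-geodesics, \<open>f x\<close> is a coarse centre of the images, which lie close to \<open>w\<close> or in
  almost the same direction as \<open>a\<close> and \<open>b\<close>. A coarse centre is unique up to a bounded error.\<close>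

lemma boundary_rigid_of_branching:
  assumes pole: "has_pole TYPE('a)" and branching: "uniformly_branching w"
  shows "boundary_rigid TYPE('a)"
  unfolding boundary_rigid_def
proof (intro allI impI, elim conjE)
  fix f :: "'a \<Rightarrow> 'a"
  assume "quasi_isometry f" and fix_bd: "\<forall>\<xi>\<in>gromov_boundary. boundary_map f \<xi> = \<xi>"
  then obtain K C where f: "quasi_isometric_embedding K C f"
    unfolding quasi_isometry_def quasi_isometry_with_def by blast
  then have K: "1 \<le> K" and upper: "\<And>x y. dist (f x) (f y) \<le> K * dist x y + C"
    unfolding quasi_isometric_embedding_def by auto
  obtain M where M: "\<And>x. \<exists>\<xi>\<in>gromov_boundary. \<forall>y\<in>\<xi>. \<forall>\<^sub>F i in sequentially. dist x w - M \<le> gp w x (y i)"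
    using pole_at_base[OF pole] by blast
  obtain A t\<^sub>0 where A: "\<And>\<xi> t. \<xi> \<in> gromov_boundary \<Longrightarrow> t\<^sub>0 \<le> t \<Longrightarrow> \<exists>\<zeta>\<in>gromov_boundary.
     ereal (t - A) \<le> boundary_product w \<xi> \<zeta> \<and> boundary_product w \<xi> \<zeta> \<le> ereal (t + A)"
    using branching unfolding uniformly_branching_def by blast
  define M' where "M' = \<bar>M\<bar> + \<bar>A\<bar> + 1 + \<delta>"
  have M': "0 \<le> M'" unfolding M'_def using delta_nonneg by simp
  define R where "R = \<bar>A\<bar> + 1 + 2 * \<delta> + 2 * M'"
  obtain B where B: "\<And>x a b. gp x a b \<le> R \<Longrightarrow> gp (f x) (f a) (f b) \<le> B"
    using quasi_isometric_embedding_gp_bounded[OF f] by blast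
  define D where "D = dist w (f w)"
  define Q where "Q = M' + B + D + 2 * \<delta>"
  define E where "E = \<bar>A\<bar> + 1 + 4 * \<delta> + B + D + 2 * Q"
  have far: "dist x (f x) \<le> E" if t0: "t\<^sub>0 \<le> dist x w" for x
  proof -
    define t where "t = dist x w"
    define h where "h = dist (f x) w"
    obtain \<xi> where \<xi>: "\<xi> \<in> gromov_boundary"
      and near: "\<And>y. y \<in> \<xi> \<Longrightarrow> \<forall>\<^sub>F i in sequentially. t - M \<le> gp w x (y i)"
      using M unfolding t_def by blast
    obtain \<zeta> where \<zeta>: "\<zeta> \<in> gromov_boundary" and *: "ereal (t - A) \<le> boundary_product w \<xi> \<zeta>"
      "boundary_product w \<xi> \<zeta> \<le> ereal (t + A)" using A[OF \<xi> t0] unfolding t_def by blast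
    obtain u where u: "u \<in> \<xi>" "f \<circ> u \<in> \<xi>" using boundary_map_fixed_representative \<xi> fix_bd by blast
    obtain v where v: "v \<in> \<zeta>" "f \<circ> v \<in> \<zeta>" using boundary_map_fixed_representative \<zeta> fix_bd by blast
    have "ereal (t - A - 1) < boundary_product w \<xi> \<zeta>" "boundary_product w \<xi> \<zeta> < ereal (t + A + 1 + 2 * \<delta> - 2 * \<delta>)"
      by (rule order_less_le_trans[OF _ *(1)], simp) (rule order_le_less_trans[OF *(2)], simp)
    then have "\<forall>\<^sub>F i in sequentially. t - A - 1 < gp w (u i) (v i)"
      and freq: "\<exists>\<^sub>F i in sequentially. gp w (u i) (v i) < t + A + 1 + 2 * \<delta>"
      using boundary_product_eventually u(1) v(1) boundary_product_frequently[OF \<xi> \<zeta> u(1) v(1)] by blast+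
    moreover have "\<forall>\<^sub>F i in sequentially. max t h \<le> gp w (u i) (f (u i))"
      using boundary_far[OF \<xi> u, of "max t h" w] by simp
    moreover have "\<forall>\<^sub>F i in sequentially. max t h \<le> gp w (v i) (f (v i))"
      using boundary_far[OF \<zeta> v, of "max t h" w] by simp
    moreover have "\<forall>\<^sub>F i in sequentially. t - M \<le> gp w x (u i)" by (rule near[OF u(1)])
    ultimately have "\<forall>\<^sub>F i in sequentially. t - A - 1 < gp w (u i) (v i) \<and> max t h \<le> gp w (u i) (f (u i)) \<and>
        max t h \<le> gp w (v i) (f (v i)) \<and> t - M \<le> gp w x (u i)"
      by (simp only: eventually_conj_iff)
    with freq obtain i where i: "gp w (u i) (v i) < t + A + 1 + 2 * \<delta>" "t - A - 1 < gp w (u i) (v i)"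
      "max t h \<le> gp w (u i) (f (u i))" "max t h \<le> gp w (v i) (f (v i))" "t - M \<le> gp w x (u i)"
      using frequently_ex[OF frequently_eventually_frequently] by blast
    define a where "a = u i"
    define b where "b = v i"
    note ab = i[folded a_def b_def]
    \<comment> \<open>All three Gromov products at \<open>x\<close> of the points \<open>w\<close>, \<open>a\<close>, \<open>b\<close> are bounded by \<open>R\<close>.\<close>
    have xa: "t - M' \<le> gp w x a" and xb: "t - M' \<le> gp w x b"
      using ab(2,5) four_point[of w x a b] delta_nonneg unfolding M'_def by linarith+
    have "gp x w a \<le> R" "gp x w b \<le> R" "gp x a b \<le> R"
      using xa xb ab(1) delta_nonneg M' gp_swap_base[of x w a] gp_swap_base[of x w b] gp_change_base[of x a b w]
      unfolding t_def[symmetric] R_def by linarith+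
    then have image: "gp (f x) (f w) (f a) \<le> B" "gp (f x) (f w) (f b) \<le> B" "gp (f x) (f a) (f b) \<le> B"
      using B by blast+
    have fa: "h - B - D \<le> gp w (f x) (f a)" and fb: "h - B - D \<le> gp w (f x) (f b)"
      using image(1,2) gp_lipschitz[of "f x" w "f a" "f w"] gp_lipschitz[of "f x" w "f b" "f w"]
        gp_swap_base[of "f x" w "f a"] gp_swap_base[of "f x" w "f b"]
      unfolding h_def D_def by linarith+
    have BD: "0 \<le> B" "0 \<le> D" using image(3) gp_nonneg order_trans unfolding D_def by (blast, simp)
    \<comment> \<open>The index \<open>i\<close> is so large that \<open>a\<close> and \<open>f a\<close> have the same direction beyond \<open>f x\<close>.\<close>
    have ya: "h - B - D - \<delta> \<le> gp w (f x) a" and yb: "h - B - D - \<delta> \<le> gp w (f x) b"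
      using fa fb ab(3,4) BD gp_commute[of w a "f a"] gp_commute[of w b "f b"]
      by (intro four_point2[of _ _ _ "f a"] four_point2[of _ _ _ "f b"]; linarith)+
    have "h - B - D - \<delta> - \<delta> \<le> gp w a b"
      using ya yb gp_commute[of w a "f x"] four_point2[of "h - B - D - \<delta>" w a "f x" b] by simp
    then have h1: "h \<le> t + \<bar>A\<bar> + 1 + 4 * \<delta> + B + D" using ab(1) by linarith
    have "t - \<bar>A\<bar> - 1 - 2 * \<delta> \<le> gp w (f a) (f b)"
      using ab(2,3,4) gp_commute[of w a "f a"] by (intro four_point3[of _ _ _ a b]) linarith+
    moreover have "gp w (f x) (f a) \<le> h" "gp w (f x) (f b) \<le> h" unfolding h_def by (rule gp_le_dist1)+
    ultimately have h2: "t - \<bar>A\<bar> - 1 - 2 * \<delta> - B \<le> h"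
      using image(3) gp_change_base[of "f x" "f a" "f b" w] unfolding h_def by linarith
    have "min t h - (M' + B + D + \<delta>) - \<delta> \<le> gp w x (f x)"
      using xa ya BD delta_nonneg M' gp_commute[of w a "f x"]
      by (intro four_point2[of _ _ _ a]) linarith+
    then have "min t h - Q \<le> gp w x (f x)" unfolding Q_def by simp
    moreover have "dist x (f x) = t + h - 2 * gp w x (f x)"
      unfolding t_def h_def by (rule dist_eq_gp)
    moreover have "t + h \<le> 2 * min t h + (\<bar>A\<bar> + 1 + 4 * \<delta> + B + D)"
      using h1 h2 delta_nonneg BD by (cases "t \<le> h") (simp_all add: min_def)
    ultimately show ?thesis unfolding E_def by linarith
  qed
  have "dist x (f x) \<le> max E (t\<^sub>0 + D + K * t\<^sub>0 + C)" for x
  proof (cases "t\<^sub>0 \<le> dist x w")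
    case True
    then show ?thesis using far[of x] by simp
  next
    case False
    then have "K * dist x w \<le> K * t\<^sub>0" using K by (intro mult_left_mono) auto
    then show ?thesis
      using False upper[of x w] dist_triangle[of x "f x" w] dist_triangle[of w "f x" "f w"]
        dist_commute[of "f x" "f w"] unfolding D_def by linarith
  qed
  then show "bdd_above (range (\<lambda>x. dist x (f x)))" by (intro bdd_aboveI2)
qed

end

section \<open>Coarse Lipschitz maps and quasi-isometries\<close>

lemma quasi_isometry_of_coarse_inverse:
  fixes f :: "'a::metric_space \<Rightarrow> 'b::metric_space"
  assumes "0 \<le> C"
    and f: "\<And>x y. dist (f x) (f y) \<le> C * dist x y + C"
    and g: "\<And>x y. dist (g x) (g y) \<le> C * dist x y + C"
    and gf: "\<And>x. dist x (g (f x)) \<le> C" and fg: "\<And>y. dist y (f (g y)) \<le> C"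
  shows "quasi_isometry f"
proof -
  define K where "K = max 1 C"
  have K: "1 \<le> K" "C \<le> K" unfolding K_def by auto
  have "dist x y / K - 3 * C \<le> dist (f x) (f y) \<and> dist (f x) (f y) \<le> K * dist x y + 3 * C" for x y
  proof
    have "dist x y \<le> dist (g (f x)) (g (f y)) + 2 * C"
      using gf[of x] gf[of y] dist_triangle[of x y "g (f x)"] dist_triangle[of "g (f x)" y "g (f y)"]
        dist_commute[of y "g (f y)"] by linarith
    also have "\<dots> \<le> C * dist (f x) (f y) + 3 * C" using g[of "f x" "f y"] by linarith
    also have "\<dots> \<le> K * dist (f x) (f y) + K * (3 * C)"
      using K assms(1) mult_right_mono[of 1 K "3 * C"] by (intro add_mono mult_right_mono) auto
    finally show "dist x y / K - 3 * C \<le> dist (f x) (f y)" using K by (simp add: field_simps)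
    have "C * dist x y \<le> K * dist x y" using K by (intro mult_right_mono) auto
    then show "dist (f x) (f y) \<le> K * dist x y + 3 * C" using f[of x y] assms(1) by linarith
  qed
  moreover have "\<exists>x. dist y (f x) \<le> 3 * C" for y
    using fg[of y] assms(1) by (intro exI[of _ "g y"]) linarith
  ultimately have "quasi_isometry_with K (3 * C) f"
    unfolding quasi_isometry_with_def quasi_isometric_embedding_def using K(1) assms(1) by simp
  then show ?thesis unfolding quasi_isometry_def by blast
qed

context gromov_space
begin

text \<open>Two points are joined by a geodesic, which is traversed in steps of length at most \<open>1\<close>.\<close>

lemma coarse_lipschitz_of_local:
  fixes f :: "'a \<Rightarrow> 'a"
  assumes "0 \<le> C" and local: "\<And>x y. dist x y \<le> 1 \<Longrightarrow> dist (f x) (f y) \<le> C"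
  shows "dist (f x) (f y) \<le> C * dist x y + C"
proof -
  let ?l = "dist x y"
  obtain \<gamma> where \<gamma>: "geodesic_on {0..?l} \<gamma>" "\<gamma> 0 = x" "\<gamma> ?l = y"
    using geodesic_space_obtains geodesic by metis
  have steps: "dist (f x) (f (\<gamma> (min (real n) ?l))) \<le> C * real n" for n
  proof (induction n)
    case 0
    then show ?case using \<gamma>(2) by simp
  next
    case (Suc n)
    have "dist (\<gamma> (min (real n) ?l)) (\<gamma> (min (real (Suc n)) ?l)) = \<bar>min (real n) ?l - min (real (Suc n)) ?l\<bar>"
      using \<gamma>(1) unfolding geodesic_on_def by simp
    also have "\<dots> \<le> 1" by (simp add: min_def)
    finally have "dist (f (\<gamma> (min (real n) ?l))) (f (\<gamma> (min (real (Suc n)) ?l))) \<le> C" by (rule local)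
    with Suc.IH have "dist (f x) (f (\<gamma> (min (real (Suc n)) ?l))) \<le> C * real n + C"
      using dist_triangle[of "f x" "f (\<gamma> (min (real (Suc n)) ?l))" "f (\<gamma> (min (real n) ?l))"] by linarith
    then show ?case by (simp add: algebra_simps)
  qed
  define N where "N = nat \<lceil>?l\<rceil>"
  have N: "?l \<le> real N" "real N \<le> ?l + 1"
  proof -
    show "?l \<le> real N" unfolding N_def by linarith
    have "real N = of_int \<lceil>?l\<rceil>" unfolding N_def by (simp add: order_trans[OF _ le_of_int_ceiling])
    then show "real N \<le> ?l + 1" by linarith
  qed
  have "dist (f x) (f y) \<le> C * real N" using steps[of N] N(1) \<gamma>(3) by simp
  also have "\<dots> \<le> C * (?l + 1)" using N(2) assms(1) by (rule mult_left_mono)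
  finally show ?thesis by (simp add: algebra_simps)
qed

text \<open>If \<open>x\<close> and \<open>f x\<close> have the same direction up to half the distance of \<open>x\<close> from \<open>w\<close>, then their Gromov
  product tends to infinity along every Gromov sequence.\<close>

lemma boundary_map_eq_self:
  fixes f :: "'a \<Rightarrow> 'a"
  assumes f: "\<And>x. dist x w / 2 - C \<le> gp w x (f x)" and \<xi>: "\<xi> \<in> gromov_boundary"
  shows "boundary_map f \<xi> = \<xi>"
proof -
  have "gromov_rel `` {f \<circ> x} = \<xi>" if x: "x \<in> \<xi>" for x
  proof -
    have far: "\<exists>N. \<forall>i\<ge>N. R \<le> gp w (x i) (f (x i))" for R
    proof -
      have "\<forall>\<^sub>F i in sequentially. 2 * R + 2 * C \<le> dist (x i) w"
        using boundary_far[OF \<xi> x x, of "2 * R + 2 * C" w] by simp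
      then have "\<forall>\<^sub>F i in sequentially. R \<le> gp w (x i) (f (x i))"
      proof eventually_elim
        case (elim i)
        then show ?case using f[of "x i"] by linarith
      qed
      then show ?thesis unfolding eventually_sequentially .
    qed
    have "\<exists>N. \<forall>i\<ge>N. \<forall>j\<ge>N. R \<le> gp w ((f \<circ> x) i) ((f \<circ> x) j)" for R
    proof -
      obtain N1 where N1: "\<And>i. N1 \<le> i \<Longrightarrow> R + 2 * \<delta> \<le> gp w (x i) (f (x i))" using far by blast
      obtain N2 where N2: "\<And>i j. N2 \<le> i \<Longrightarrow> N2 \<le> j \<Longrightarrow> R + 2 * \<delta> \<le> gp w (x i) (x j)"
        using boundary_sequence[OF \<xi> x] unfolding gromov_sequence_iff_ge[of _ w] by blast
      have "R \<le> gp w (f (x i)) (f (x j))" if "max N1 N2 \<le> i" "max N1 N2 \<le> j" for i j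
        using four_point3[of "R + 2 * \<delta>" w "f (x i)" "x i" "x j" "f (x j)"] N1[of i] N1[of j] N2[of i j] that
        by (simp add: gp_commute)
      then show ?thesis unfolding comp_apply by blast
    qed
    then have "(x, f \<circ> x) \<in> gromov_rel"
      unfolding gromov_rel_iff_ge[of _ _ w] using boundary_sequence[OF \<xi> x] far
      by (simp add: gromov_sequence_iff_ge[of _ w])
    then show ?thesis using boundary_class[OF \<xi>] boundary_class[OF \<xi> x] by blast
  qed
  then show ?thesis using boundary_nonempty[OF \<xi>] unfolding boundary_map_def by blast
qed

section \<open>Sliding along corridors\<close>

text \<open>The \<open>n\<close>-th corridor consists of the points at distance \<open>a n\<close> to \<open>b n\<close> from \<open>w\<close> in the direction
  of \<open>z n\<close>. By the last assumption nothing branches off there: the corridor is coarsely a segment of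
  the geodesic \<open>\<gamma> n\<close> from \<open>w\<close> to \<open>z n\<close>, and the rest of the space is attached only at its ends.\<close>

context
  fixes w :: 'a and a b :: "nat \<Rightarrow> real" and z :: "nat \<Rightarrow> 'a" and \<gamma> :: "nat \<Rightarrow> real \<Rightarrow> 'a" and C :: real
  assumes a_nonneg: "\<And>n. 0 \<le> a n" and a_less_b: "\<And>n. a n < b n" and gap: "\<And>n. b n + 1 < a (Suc n)"
    and geodesic_z: "\<And>n. geodesic_on {0..dist w (z n)} (\<gamma> n)" "\<And>n. \<gamma> n 0 = w" "\<And>n. \<gamma> n (dist w (z n)) = z n"
    and b_le: "\<And>n. b n \<le> dist w (z n)" and C_nonneg: "0 \<le> C"
    and corridor: "\<And>n x. a n \<le> gp w x (z n) \<Longrightarrow> min (dist x w) (b n) - C \<le> gp w x (z n)"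
begin

definition in_corridor :: "nat \<Rightarrow> 'a \<Rightarrow> bool" where
  "in_corridor n x \<longleftrightarrow> a n \<le> gp w x (z n) \<and> dist x w \<le> b n"

definition slide :: "(nat \<Rightarrow> real \<Rightarrow> real) \<Rightarrow> 'a \<Rightarrow> 'a" where
  "slide \<phi> x = (if \<exists>n. in_corridor n x then let n = THE n. in_corridor n x in \<gamma> n (\<phi> n (dist x w)) else x)"

definition reparametrization :: "(nat \<Rightarrow> real \<Rightarrow> real) \<Rightarrow> bool" where
  "reparametrization \<phi> \<longleftrightarrow> (\<forall>n. \<phi> n (a n) = a n \<and> \<phi> n (b n) = b n \<and>
     (\<forall>s\<in>{a n..b n}. \<phi> n s \<in> {a n..b n} \<and> (\<forall>t\<in>{a n..b n}. \<bar>\<phi> n s - \<phi> n t\<bar> \<le> 2 * \<bar>s - t\<bar>)))"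

lemma b_less_a: "n < m \<Longrightarrow> b n + 1 < a m"
proof (induction m)
  case (Suc m)
  then show ?case using gap[of m] a_less_b[of m] by (cases "n = m") auto
qed simp

lemma in_corridor_dist: "in_corridor n x \<Longrightarrow> dist x w \<in> {a n..b n}"
  using gp_le_dist1[of w x "z n"] unfolding in_corridor_def by auto

lemma in_corridor_same:
  assumes "in_corridor n x" "in_corridor m y" "dist x y \<le> 1" shows "n = m"
  using in_corridor_dist[OF assms(1)] in_corridor_dist[OF assms(2)] assms(3) b_less_a[of n m] b_less_a[of m n]
    dist_triangle[of x w y] dist_triangle[of y w x] dist_commute[of x y]
  by (cases n m rule: linorder_cases) auto

lemma slide_in: "in_corridor n x \<Longrightarrow> slide \<phi> x = \<gamma> n (\<phi> n (dist x w))"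
proof -
  assume n: "in_corridor n x"
  have "dist x x \<le> 1" by simp
  then have "(THE n. in_corridor n x) = n" using n in_corridor_same by blast
  with n show ?thesis unfolding slide_def by auto
qed

lemma slide_out: "(\<And>n. \<not> in_corridor n x) \<Longrightarrow> slide \<phi> x = x"
  unfolding slide_def by simp

lemma corridor_axis:
  assumes "s \<in> {a n..b n}"
  shows "dist (\<gamma> n s) w = s" "gp w (\<gamma> n s) (z n) = s" "in_corridor n (\<gamma> n s)"
proof -
  have s: "0 \<le> s" "s \<le> dist w (z n)" using assms a_nonneg[of n] b_le[of n] by auto
  then show 1: "dist (\<gamma> n s) w = s" and 2: "gp w (\<gamma> n s) (z n) = s"
    using geodesic_z(1)[of n] gp_geodesic_start[OF geodesic_z(1), of 0 n s "dist w (z n)"] geodesic_z(2,3)[of n]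
    unfolding geodesic_on_def by (force, simp)
  show "in_corridor n (\<gamma> n s)" unfolding in_corridor_def 1 2 using assms by simp
qed

lemma dist_corridor_axis:
  "s \<in> {a n..b n} \<Longrightarrow> t \<in> {a n..b n} \<Longrightarrow> dist (\<gamma> n s) (\<gamma> n t) = \<bar>s - t\<bar>"
  "s \<in> {a n..b n} \<Longrightarrow> t \<in> {a n..b n} \<Longrightarrow> gp w (\<gamma> n s) (\<gamma> n t) = min s t"
proof -
  assume st: "s \<in> {a n..b n}" "t \<in> {a n..b n}"
  then have "0 \<le> s" "s \<le> dist w (z n)" "0 \<le> t" "t \<le> dist w (z n)"
    using a_nonneg[of n] b_le[of n] by auto
  then show "dist (\<gamma> n s) (\<gamma> n t) = \<bar>s - t\<bar>" "gp w (\<gamma> n s) (\<gamma> n t) = min s t"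
    using geodesic_z(1)[of n] gp_geodesic_start[OF geodesic_z(1), of 0 n s t] geodesic_z(2)[of n]
    unfolding geodesic_on_def by auto
qed

lemma gp_corridor_axis:
  assumes "in_corridor n x" shows "dist x w - C - \<delta> \<le> gp w x (\<gamma> n (dist x w))"
proof (rule four_point2)
  show "dist x w - C \<le> gp w x (z n)" using corridor[of n x] assms unfolding in_corridor_def by auto
  show "dist x w - C \<le> gp w (z n) (\<gamma> n (dist x w))"
    using corridor_axis(2)[OF in_corridor_dist[OF assms]] C_nonneg gp_commute[of w "z n"] by simp
qed

lemma near_corridor_axis:
  assumes "in_corridor n x" shows "dist x (\<gamma> n (dist x w)) \<le> 2 * C + 2 * \<delta>"
  using gp_corridor_axis[OF assms] corridor_axis(1)[OF in_corridor_dist[OF assms]]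
    dist_eq_gp[of x "\<gamma> n (dist x w)" w] by linarith

text \<open>The slide first projects to the axis of the corridor, at bounded cost, and then moves along it.\<close>

lemma slide_displacement:
  assumes \<phi>: "reparametrization \<phi>" and n: "in_corridor n x"
  shows "dist x (slide \<phi> x) \<le> 2 * C + 2 * \<delta> + \<bar>dist x w - \<phi> n (dist x w)\<bar>"
proof -
  have "\<phi> n (dist x w) \<in> {a n..b n}" using \<phi> in_corridor_dist[OF n] unfolding reparametrization_def by blast
  then have "dist (\<gamma> n (dist x w)) (slide \<phi> x) = \<bar>dist x w - \<phi> n (dist x w)\<bar>"
    unfolding slide_in[OF n] by (rule dist_corridor_axis(1)[OF in_corridor_dist[OF n]])
  then show ?thesis
    using near_corridor_axis[OF n] dist_triangle[of x "slide \<phi> x" "\<gamma> n (dist x w)"] by linarith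
qed

text \<open>A point of the corridor that has a neighbour outside lies near one of the two ends, which
  \<open>\<phi>\<close> fixes.\<close>

lemma slide_displacement_at_end:
  assumes \<phi>: "reparametrization \<phi>" and n: "in_corridor n x" and y: "\<not> in_corridor n y" "dist x y \<le> 1"
  shows "dist x (slide \<phi> x) \<le> 5 * C + 2 * \<delta> + 3"
proof -
  let ?h = "dist x w"
  have h: "?h \<in> {a n..b n}" by (rule in_corridor_dist[OF n])
  have ends: "a n \<in> {a n..b n}" "b n \<in> {a n..b n}" using a_less_b[of n] by auto
  have "?h - a n \<le> C + 1 \<or> b n - ?h \<le> 1"
  proof (cases "dist y w \<le> b n")
    case True
    then have "gp w y (z n) < a n" using y(1) unfolding in_corridor_def by auto
    moreover have "gp w x (z n) \<le> gp w y (z n) + dist x y" by (rule gp_lipschitz)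
    moreover have "?h - C \<le> gp w x (z n)" using corridor[of n x] n unfolding in_corridor_def by auto
    ultimately show ?thesis using y(2) by linarith
  next
    case False
    then show ?thesis using dist_triangle[of y w x] y(2) dist_commute[of x y] by linarith
  qed
  moreover have "\<bar>\<phi> n ?h - a n\<bar> \<le> 2 * \<bar>?h - a n\<bar>" "\<bar>\<phi> n ?h - b n\<bar> \<le> 2 * \<bar>?h - b n\<bar>"
    using \<phi> h ends unfolding reparametrization_def by (metis, metis)
  ultimately have "\<bar>?h - \<phi> n ?h\<bar> \<le> 3 * C + 3" using h C_nonneg by auto
  then show ?thesis using slide_displacement[OF \<phi> n] by linarith
qed

text \<open>Distances from \<open>w\<close> in different corridors differ by more than \<open>1\<close>, so two points at distance at most
  \<open>1\<close> that are not in the same corridor are both displaced by a bounded amount only.\<close>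

lemma slide_local:
  assumes \<phi>: "reparametrization \<phi>" and "dist x y \<le> 1"
  shows "dist (slide \<phi> x) (slide \<phi> y) \<le> 10 * C + 4 * \<delta> + 7"
proof -
  have one: "dist (slide \<phi> x) (slide \<phi> y) \<le> 10 * C + 4 * \<delta> + 7"
    if xy: "dist x y \<le> 1" and n: "in_corridor n x" for x y n
  proof (cases "in_corridor n y")
    case True
    let ?s = "dist x w" and ?t = "dist y w"
    have st: "?s \<in> {a n..b n}" "?t \<in> {a n..b n}" using in_corridor_dist n True by blast+
    then have "dist (slide \<phi> x) (slide \<phi> y) = \<bar>\<phi> n ?s - \<phi> n ?t\<bar>"
      unfolding slide_in[OF n] slide_in[OF True]
      using \<phi> by (intro dist_corridor_axis(1)) (auto simp: reparametrization_def)
    also have "\<dots> \<le> 2 * \<bar>?s - ?t\<bar>" using \<phi> st unfolding reparametrization_def by blast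
    also have "\<bar>?s - ?t\<bar> \<le> 1"
      using xy dist_triangle[of x w y] dist_triangle[of y w x] dist_commute[of x y] by linarith
    finally show ?thesis using C_nonneg delta_nonneg by linarith
  next
    case False
    have "dist x (slide \<phi> x) \<le> 5 * C + 2 * \<delta> + 3" by (rule slide_displacement_at_end[OF \<phi> n False xy])
    moreover have "dist y (slide \<phi> y) \<le> 5 * C + 2 * \<delta> + 3"
    proof (cases "\<exists>m. in_corridor m y")
      case True
      then show ?thesis using in_corridor_same[OF n _ xy] False by blast
    next
      case False
      then have "slide \<phi> y = y" by (intro slide_out) blast
      then show ?thesis using C_nonneg delta_nonneg by simp
    qed
    ultimately show ?thesis
      using xy dist_triangle[of "slide \<phi> x" "slide \<phi> y" x] dist_triangle[of x "slide \<phi> y" y]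
        dist_commute[of x "slide \<phi> x"] by linarith
  qed
  consider n where "in_corridor n x" | n where "in_corridor n y"
    | "slide \<phi> x = x" "slide \<phi> y = y" using slide_out by blast
  then show ?thesis
  proof cases
    case 2
    then show ?thesis using one[of y x] assms(2) by (simp add: dist_commute)
  qed (use one assms(2) C_nonneg delta_nonneg in auto)
qed

lemma slide_inverse:
  assumes \<phi>: "reparametrization \<phi>" and inv: "\<And>n s. s \<in> {a n..b n} \<Longrightarrow> \<psi> n (\<phi> n s) = s"
  shows "dist x (slide \<psi> (slide \<phi> x)) \<le> 2 * C + 2 * \<delta>"
proof (cases "\<exists>n. in_corridor n x")
  case True
  then obtain n where n: "in_corridor n x" by blast
  have "\<phi> n (dist x w) \<in> {a n..b n}" using \<phi> in_corridor_dist[OF n] unfolding reparametrization_def by blast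
  then have "slide \<psi> (slide \<phi> x) = \<gamma> n (\<psi> n (\<phi> n (dist x w)))"
    unfolding slide_in[OF n] using slide_in[OF corridor_axis(3)] corridor_axis(1) by simp
  also have "\<dots> = \<gamma> n (dist x w)" using inv in_corridor_dist[OF n] by simp
  finally show ?thesis using near_corridor_axis[OF n] by simp
next
  case False
  then have "slide \<phi> x = x" "slide \<psi> x = x" by (auto intro!: slide_out)
  then show ?thesis using C_nonneg delta_nonneg by simp
qed

lemma quasi_isometry_slide:
  assumes \<phi>: "reparametrization \<phi>" and \<psi>: "reparametrization \<psi>"
    and inv: "\<And>n s. s \<in> {a n..b n} \<Longrightarrow> \<psi> n (\<phi> n s) = s" "\<And>n s. s \<in> {a n..b n} \<Longrightarrow> \<phi> n (\<psi> n s) = s"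
  shows "quasi_isometry (slide \<phi>)"
proof -
  have nonneg: "0 \<le> 10 * C + 4 * \<delta> + 7" using C_nonneg delta_nonneg by simp
  show ?thesis
  proof (rule quasi_isometry_of_coarse_inverse[OF nonneg])
    show "dist (slide \<phi> x) (slide \<phi> y) \<le> (10 * C + 4 * \<delta> + 7) * dist x y + (10 * C + 4 * \<delta> + 7)" for x y
      by (rule coarse_lipschitz_of_local[OF nonneg slide_local[OF \<phi>]])
    show "dist (slide \<psi> x) (slide \<psi> y) \<le> (10 * C + 4 * \<delta> + 7) * dist x y + (10 * C + 4 * \<delta> + 7)" for x y
      by (rule coarse_lipschitz_of_local[OF nonneg slide_local[OF \<psi>]])
    show "dist x (slide \<psi> (slide \<phi> x)) \<le> 10 * C + 4 * \<delta> + 7" for x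
      using slide_inverse[of \<phi> \<psi> x, OF \<phi> inv(1)] C_nonneg delta_nonneg by linarith
    show "dist x (slide \<phi> (slide \<psi> x)) \<le> 10 * C + 4 * \<delta> + 7" for x
      using slide_inverse[of \<psi> \<phi> x, OF \<psi> inv(2)] C_nonneg delta_nonneg by linarith
  qed
qed

text \<open>A slide moves points along a geodesic from \<open>w\<close> and at most halves their distance from \<open>w\<close>, so it
  preserves half of their direction.\<close>

lemma gp_slide:
  assumes \<phi>: "reparametrization \<phi>" and half: "\<And>n s. s \<in> {a n..b n} \<Longrightarrow> s / 2 \<le> \<phi> n s"
  shows "dist x w / 2 - (C + 2 * \<delta>) \<le> gp w x (slide \<phi> x)"
proof (cases "\<exists>n. in_corridor n x")
  case True
  then obtain n where n: "in_corridor n x" by blast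
  let ?h = "dist x w"
  have h: "?h \<in> {a n..b n}" "\<phi> n ?h \<in> {a n..b n}"
    using \<phi> in_corridor_dist[OF n] unfolding reparametrization_def by blast+
  have "?h / 2 - C - \<delta> - \<delta> \<le> gp w x (slide \<phi> x)"
  proof (rule four_point2)
    have "?h / 2 \<le> ?h" by simp
    then show "?h / 2 - C - \<delta> \<le> gp w x (\<gamma> n ?h)" using gp_corridor_axis[OF n] by linarith
    have "?h / 2 \<le> min ?h (\<phi> n ?h)" using half[OF h(1)] by simp
    then show "?h / 2 - C - \<delta> \<le> gp w (\<gamma> n ?h) (slide \<phi> x)"
      unfolding slide_in[OF n] dist_corridor_axis(2)[OF h] using C_nonneg delta_nonneg by linarith
  qed
  then show ?thesis by simp
next
  case False
  then have "slide \<phi> x = x" by (intro slide_out) blast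
  then have "gp w x (slide \<phi> x) = dist x w" by simp
  moreover have "dist x w / 2 \<le> dist x w" by simp
  ultimately show ?thesis using C_nonneg delta_nonneg by linarith
qed

text \<open>The slide \<open>s \<mapsto> max ((a + s) / 2) (2 * s - b)\<close> of \<open>[a, b]\<close> has slope \<open>1/2\<close> on the first two thirds
  and slope \<open>2\<close> on the last third, and moves the point between them by \<open>(b - a) / 3\<close>.\<close>

lemma not_boundary_rigid_of_corridors:
  assumes long: "\<And>n. real n \<le> b n - a n"
  shows "\<not> boundary_rigid TYPE('a)"
proof
  assume rigid: "boundary_rigid TYPE('a)"
  define \<phi> where "\<phi> = (\<lambda>n s. max (a n / 2 + s / 2) (2 * s - b n))"
  define \<psi> where "\<psi> = (\<lambda>n s. min (2 * s - a n) (s / 2 + b n / 2))"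
  have \<phi>: "reparametrization \<phi>" and \<psi>: "reparametrization \<psi>"
    using less_imp_le[OF a_less_b] not_le[THEN iffD2, OF a_less_b]
    unfolding reparametrization_def \<phi>_def \<psi>_def
    by (auto simp: max_def min_def abs_if field_simps)
  have "quasi_isometry (slide \<phi>)"
    by (rule quasi_isometry_slide[OF \<phi> \<psi>]) (auto simp: \<phi>_def \<psi>_def max_def min_def field_simps)
  moreover have "\<forall>\<xi>\<in>gromov_boundary. boundary_map (slide \<phi>) \<xi> = \<xi>"
  proof
    fix \<xi> :: "(nat \<Rightarrow> 'a) set" assume "\<xi> \<in> gromov_boundary"
    moreover have "s / 2 \<le> \<phi> n s" for n s using a_nonneg[of n] by (simp add: \<phi>_def le_max_iff_disj)
    ultimately show "boundary_map (slide \<phi>) \<xi> = \<xi>"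
      using gp_slide[OF \<phi>] by (intro boundary_map_eq_self) blast+
  qed
  ultimately have "bdd_above (range (\<lambda>x. dist x (slide \<phi> x)))"
    using spec[OF rigid[unfolded boundary_rigid_def], of "slide \<phi>"] by simp
  then obtain B where B: "\<And>x. dist x (slide \<phi> x) \<le> B" unfolding bdd_above_def by auto
  obtain n :: nat where n: "3 * B < real n" using reals_Archimedean2 by blast
  define s where "s = a n / 3 + 2 * b n / 3"
  have s: "s \<in> {a n..b n}" "\<phi> n s = 2 * a n / 3 + b n / 3" "\<phi> n s \<in> {a n..b n}"
    using a_less_b[of n] unfolding s_def \<phi>_def by (auto simp: field_simps)
  have "slide \<phi> (\<gamma> n s) = \<gamma> n (\<phi> n s)"
    using slide_in[OF corridor_axis(3)[OF s(1)]] corridor_axis(1)[OF s(1)] by simp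
  then have "dist (\<gamma> n s) (slide \<phi> (\<gamma> n s)) = \<bar>s - \<phi> n s\<bar>" using dist_corridor_axis(1)[OF s(1,3)] by simp
  then have "\<bar>s - \<phi> n s\<bar> \<le> B" using B by metis
  then show False using n long[of n] unfolding s(2) unfolding s_def by (simp add: field_simps)
qed

end

section \<open>Boundary rigidity implies uniform branching\<close>

text \<open>If nothing branches off from \<open>\<xi>\<close> at distances between \<open>t - A\<close> and \<open>t + A\<close>, then a point \<open>x\<close> whose
  direction agrees with \<open>\<xi>\<close> beyond \<open>t - A\<close> must follow \<open>\<xi>\<close> up to \<open>t + A\<close>: by the pole, \<open>x\<close> lies
  near a geodesic from \<open>w\<close> to some boundary point \<open>\<zeta>\<close>, whose direction agrees with \<open>\<xi>\<close> beyond \<open>t - A\<close> and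
  hence, as nothing branches off, beyond \<open>t + A\<close>.\<close>

lemma corridor_of_not_branching:
  assumes pole: "\<And>x. \<exists>\<xi>\<in>gromov_boundary. \<forall>y\<in>\<xi>. \<forall>\<^sub>F i in sequentially. dist x w - M \<le> gp w x (y i :: 'a)"
    and M: "0 \<le> M" and nbr: "\<not> uniformly_branching w" and "0 \<le> l"
  obtains a b z where "r \<le> a" "a + l \<le> b" "b \<le> dist w z"
    "\<And>x. a \<le> gp w x z \<Longrightarrow> min (dist x w) b - (M + 2 * \<delta>) \<le> gp w x z"
proof -
  \<comment> \<open>The corridor is the window around \<open>t\<close> without its first \<open>M + 4 * \<delta>\<close>, which absorb the error in
    following \<open>x\<close> to the boundary.\<close>
  define A where "A = l + M + 4 * \<delta>"
  obtain \<xi> t where \<xi>: "\<xi> \<in> gromov_boundary" and t: "r + A \<le> t"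
    and gap: "\<And>\<zeta>. \<zeta> \<in> gromov_boundary \<Longrightarrow> ereal (t - A) \<le> boundary_product w \<xi> \<zeta> \<Longrightarrow>
      ereal (t + A) < boundary_product w \<xi> (\<zeta> :: (nat \<Rightarrow> 'a) set)"
    using nbr unfolding uniformly_branching_def by (meson not_le)
  define a where "a = t - A + (M + 4 * \<delta>)"
  define b where "b = t + A"
  obtain u where u: "u \<in> \<xi>" "gromov_sequence u" using boundary_nonempty[OF \<xi>] by blast
  obtain N where N: "\<And>i j. N \<le> i \<Longrightarrow> N \<le> j \<Longrightarrow> b \<le> gp w (u i) (u j)"
    using u(2) unfolding gromov_sequence_iff_ge[of _ w] by metis
  define z where "z = u N"
  have ab: "a + l \<le> b" unfolding a_def b_def A_def using \<open>0 \<le> l\<close> M delta_nonneg by simp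
  show thesis
  proof (rule that)
    show "r \<le> a" using t M delta_nonneg unfolding a_def by linarith
    show "a + l \<le> b" by fact
    show "b \<le> dist w z" using N[of N N] unfolding z_def by (simp add: dist_commute)
    fix x assume x: "a \<le> gp w x z"
    let ?h = "dist x w"
    have h: "a \<le> ?h" using x gp_le_dist1[of w x z] by linarith
    obtain \<zeta> v where \<zeta>: "\<zeta> \<in> gromov_boundary" "v \<in> \<zeta>"
      and v: "\<forall>\<^sub>F i in sequentially. ?h - M \<le> gp w x (v i)"
      using pole boundary_nonempty by metis
    have "\<forall>\<^sub>F i in sequentially. t - A + 2 * \<delta> \<le> gp w (u i) (v i)"
      using v eventually_ge_at_top[of N]
    proof eventually_elim
      case (elim i)
      have "a - M \<le> gp w (u i) z" "a - M \<le> gp w z x" "a - M \<le> gp w x (v i)"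
        using N[of i N] elim x h M ab \<open>0 \<le> l\<close> gp_commute[of w x z] unfolding z_def by auto
      then have "a - M - 2 * \<delta> \<le> gp w (u i) (v i)" by (rule four_point3)
      then show ?case unfolding a_def by simp
    qed
    from boundary_product_ge[OF \<xi> \<zeta>(1) u(1) \<zeta>(2) this] have "ereal (t - A) \<le> boundary_product w \<xi> \<zeta>"
      by simp
    then have "ereal b < boundary_product w \<xi> \<zeta>" unfolding b_def by (rule gap[OF \<zeta>(1)])
    then have "\<forall>\<^sub>F i in sequentially. b < gp w (u i) (v i)"
      by (rule boundary_product_eventually[OF _ u(1) \<zeta>(2)])
    with v have "\<forall>\<^sub>F i in sequentially. min ?h b - (M + 2 * \<delta>) \<le> gp w x z"
      using eventually_ge_at_top[of N]
    proof eventually_elim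
      case (elim i)
      have "min ?h b - M \<le> gp w x (v i)" "min ?h b - M \<le> gp w (v i) (u i)" "min ?h b - M \<le> gp w (u i) z"
        using N[of i N] elim M gp_commute[of w "v i" "u i"] unfolding z_def by auto
      then have "min ?h b - M - 2 * \<delta> \<le> gp w x z" by (rule four_point3)
      then show ?case by simp
    qed
    then show "min ?h b - (M + 2 * \<delta>) \<le> gp w x z" by simp
  qed
qed

text \<open>Corridors exist at arbitrarily large distances from \<open>w\<close> and with arbitrarily large lengths, so a
  sequence of them with disjoint ranges of distances and unbounded lengths can be chosen.\<close>

lemma branching_of_boundary_rigid:
  assumes pole: "has_pole TYPE('a)" and rigid: "boundary_rigid TYPE('a)"
  shows "uniformly_branching (w :: 'a)"
proof (rule ccontr)
  assume nbr: "\<not> uniformly_branching w"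
  obtain M where M: "\<And>x. \<exists>\<xi>\<in>gromov_boundary. \<forall>y\<in>\<xi>. \<forall>\<^sub>F i in sequentially. dist x w - M \<le> gp w x (y i)"
    using pole_at_base[OF pole] by blast
  define M' where "M' = max M 0"
  have M': "\<exists>\<xi>\<in>gromov_boundary. \<forall>y\<in>\<xi>. \<forall>\<^sub>F i in sequentially. dist x w - M' \<le> gp w x (y i)" for x
  proof -
    obtain \<xi> where \<xi>: "\<xi> \<in> gromov_boundary" "\<And>y. y \<in> \<xi> \<Longrightarrow> \<forall>\<^sub>F i in sequentially. dist x w - M \<le> gp w x (y i)"
      using M by blast
    have "\<forall>\<^sub>F i in sequentially. dist x w - M' \<le> gp w x (y i)" if "y \<in> \<xi>" for y
      using \<xi>(2)[OF that] by (rule eventually_mono) (simp add: M'_def)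
    with \<xi>(1) show ?thesis by blast
  qed
  have M'_nonneg: "0 \<le> M'" unfolding M'_def by simp
  define P where "P = (\<lambda>n (a, b, z). 0 \<le> a \<and> a + real (Suc n) \<le> b \<and> b \<le> dist w z \<and>
    (\<forall>x. a \<le> gp w x z \<longrightarrow> min (dist x w) b - (M' + 2 * \<delta>) \<le> gp w x z))"
  define Q where "Q = (\<lambda>(n::nat) (a::real, b::real, z::'a) (a'::real, b'::real, z'::'a). b + 1 < a')"
  have ex: "\<exists>p. P n p \<and> r < fst p" for n r
  proof -
    obtain a b z where "max 0 (r + 1) \<le> a" "a + real (Suc n) \<le> b" "b \<le> dist w z"
      "\<And>x. a \<le> gp w x z \<Longrightarrow> min (dist x w) b - (M' + 2 * \<delta>) \<le> gp w x z"
      using corridor_of_not_branching[OF M' M'_nonneg nbr, of "real (Suc n)" "max 0 (r + 1)"] by auto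
    then show ?thesis unfolding P_def by (intro exI[of _ "(a, b, z)"]) auto
  qed
  have "\<exists>g. \<forall>n. P n (g n) \<and> Q n (g n) (g (Suc n))"
  proof (rule dependent_nat_choice)
    show "\<exists>p. P 0 p" using ex by blast
    show "\<exists>q. P (Suc n) q \<and> Q n p q" for p n
      using ex[of "Suc n" "fst (snd p) + 1"] unfolding Q_def by (auto simp: case_prod_beta)
  qed
  then obtain g where g: "\<And>n. P n (g n)" "\<And>n. Q n (g n) (g (Suc n))" by blast
  define a where "a = (\<lambda>n. fst (g n))"
  define b where "b = (\<lambda>n. fst (snd (g n)))"
  define z where "z = (\<lambda>n. snd (snd (g n)))"
  have abz: "0 \<le> a n" "a n + real (Suc n) \<le> b n" "b n \<le> dist w (z n)" "b n + 1 < a (Suc n)"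
    "\<And>x. a n \<le> gp w x (z n) \<Longrightarrow> min (dist x w) (b n) - (M' + 2 * \<delta>) \<le> gp w x (z n)" for n
    using g(1)[of n] g(2)[of n] unfolding P_def Q_def a_def b_def z_def by (auto simp: case_prod_beta)
  have "\<forall>n. \<exists>\<gamma>. geodesic_on {0..dist w (z n)} \<gamma> \<and> \<gamma> 0 = w \<and> \<gamma> (dist w (z n)) = z n"
    using geodesic_space_obtains[OF geodesic] by metis
  then obtain \<gamma> where \<gamma>: "\<And>n. geodesic_on {0..dist w (z n)} (\<gamma> n)" "\<And>n. \<gamma> n 0 = w"
    "\<And>n. \<gamma> n (dist w (z n)) = z n" by metis
  have ab: "a n < b n" "real n \<le> b n - a n" for n using abz(2)[of n] by simp_all
  have "0 \<le> M' + 2 * \<delta>" using M'_nonneg delta_nonneg by simp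
  from not_boundary_rigid_of_corridors[OF abz(1) ab(1) abz(4) \<gamma> abz(3) this abz(5) ab(2)] rigid
  show False by blast
qed

end

section \<open>The equivalence\<close>

lemma gromov_space_of_thin_triangles:
  assumes "geodesic_space TYPE('a::metric_space)" "thin_triangles \<delta> TYPE('a)"
  shows "gromov_space TYPE('a) \<delta>"
  using assms four_point_of_thin_triangles by unfold_locales

theorem theorem1p4:
  assumes proper: "\<forall>(x::'a::metric_space) r. compact (cball x r)"
    and geodesic: "geodesic_space TYPE('a)"
    and hyperbolic: "gromov_hyperbolic TYPE('a)"
    and pole: "has_pole TYPE('a)"
  shows "boundary_rigid TYPE('a) \<longleftrightarrow> boundary_uniformly_perfect TYPE('a)"
proof
  assume rigid: "boundary_rigid TYPE('a)"
  obtain \<delta>\<^sub>0 where \<delta>\<^sub>0: "delta_hyperbolic \<delta>\<^sub>0 TYPE('a)"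
    using hyperbolic unfolding gromov_hyperbolic_def by blast
  then have "0 \<le> \<delta>\<^sub>0" unfolding delta_hyperbolic_def by blast
  \<comment> \<open>A visual metric requires a positive constant for which triangles are slim as well as thin.\<close>
  define \<delta> where "\<delta> = max (6 * \<delta>\<^sub>0) 1"
  have "0 < \<delta>" "\<delta>\<^sub>0 \<le> \<delta>" "6 * \<delta>\<^sub>0 \<le> \<delta>" using \<open>0 \<le> \<delta>\<^sub>0\<close> unfolding \<delta>_def by auto
  then have \<delta>: "0 < \<delta>" "delta_hyperbolic \<delta> TYPE('a)" "thin_triangles \<delta> TYPE('a)"
    using delta_hyperbolic_mono[OF \<delta>\<^sub>0] thin_triangles_mono[OF thin_triangles_of_delta_hyperbolic[OF \<delta>\<^sub>0]]
    by blast+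
  interpret gromov_space "TYPE('a)" \<delta> by (rule gromov_space_of_thin_triangles[OF geodesic \<delta>(3)])
  have "0 < min 1 (1 / (5 * \<delta>))" using \<delta>(1) by simp
  then obtain \<epsilon> where \<epsilon>: "0 < \<epsilon>" "\<epsilon> < min 1 (1 / (5 * \<delta>))" using dense by blast
  then have "\<epsilon> * \<delta> \<le> 1 / 5" using \<delta>(1) by (simp add: field_simps)
  define w :: 'a where "w = undefined"
  have "uniformly_branching w" by (rule branching_of_boundary_rigid[OF pole rigid])
  then have "uniformly_perfect gromov_boundary (visual_dist w \<epsilon>)"
    using uniformly_perfect_iff_branching[OF \<epsilon>(1) \<open>\<epsilon> * \<delta> \<le> 1 / 5\<close>] by blast
  moreover have "visual_metric (visual_dist w \<epsilon>)" unfolding visual_metric_def using \<delta> \<epsilon> by blast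
  ultimately show "boundary_uniformly_perfect TYPE('a)" unfolding boundary_uniformly_perfect_def by blast
next
  assume "boundary_uniformly_perfect TYPE('a)"
  then obtain w :: 'a and \<delta> \<epsilon> where \<delta>: "0 < \<delta>" "thin_triangles \<delta> TYPE('a)"
    and \<epsilon>: "0 < \<epsilon>" "\<epsilon> < min 1 (1 / (5 * \<delta>))"
    and perfect: "uniformly_perfect gromov_boundary (visual_dist w \<epsilon>)"
    unfolding boundary_uniformly_perfect_def visual_metric_def by blast
  interpret gromov_space "TYPE('a)" \<delta> by (rule gromov_space_of_thin_triangles[OF geodesic \<delta>(2)])
  have "\<epsilon> * \<delta> \<le> 1 / 5" using \<epsilon> \<delta>(1) by (simp add: field_simps)
  with perfect have "uniformly_branching w" using uniformly_perfect_iff_branching[OF \<epsilon>(1)] by blast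
  then show "boundary_rigid TYPE('a)" by (rule boundary_rigid_of_branching[OF pole])
qed

end
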